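(* Let $X_1,\dots,X_d$ be $\sigma$-finite measure spaces, $f\in L^2(X_1\times\dots\times X_d)$, $r\in\mathbb{N}$, and $\mu_1,\dots,\mu_d\in[0,1]$. If $$\prod_{k=1}^d\mu_k<\frac{1}{r-1}$$ (interpreted as no restriction when $r=1$), or equivalently $\prod_{k=1}^d(1+\omega_k)>r-1$ with $\omega_k=(1-\mu_k)/\mu_k$, then the infimum $$\eta=\inf\Big\{\Big\lVert f-\sum_{p=1}^r\lambda_p\,\varphi_{1p}\otimes\dots\otimes\varphi_{dp}\Big\rVert:\ \boldsymbol\lambda\in\mathbb{C}^r,\ \varphi_{kp}\in L^2(X_k),\ \lVert\varphi_{kp}\rVert=1,\ \mu(\varphi_{k1},\dots,\varphi_{kr})\le\mu_k\ \text{for } k=1,\dots,d\Big\}$$ is attained.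
   Context: $\varphi_1\otimes\dots\otimes\varphi_d$ denotes the function $(\mathbf{x}_1,\dots,\mathbf{x}_d)\mapsto\prod_k\varphi_k(\mathbf{x}_k)$; norms are $L^2$ norms. For unit vectors $\varphi_1,\dots,\varphi_r$ in a Hilbert space, the coherence is $\mu(\varphi_1,\dots,\varphi_r)=\max_{p\ne q}\lvert\langle\varphi_p,\varphi_q\rangle\rvert$. The relative incoherence is $\omega=(1-\mu)/\mu\in[0,\infty]$ (with $\omega=\infty$ when $\mu=0$); the constraint $\mu(\varphi_{k1},\dots,\varphi_{kr})\le\mu_k$ is the same as $\omega(\varphi_{k1},\dots,\varphi_{kr})\ge\omega_k$.
   Formalization: It is additionally assumed that unit vectors meeting the coherence constraints exist (otherwise the infimum is over the empty set and cannot be attained, e.g. X_1 a single point, r = 2, μ_1 = 0); the equivalent condition in terms of ω_k is not stated. *)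

theory Defs
  imports "HOL-Analysis.Analysis"
begin

text \<open>Square-integrable complex-valued functions on a measure space (represented by
functions, not equivalence classes), the L2 norm and the L2 inner product.\<close>

definition L2 :: "'a measure \<Rightarrow> ('a \<Rightarrow> complex) set" where
  "L2 M = {g. g \<in> borel_measurable M \<and> integrable M (\<lambda>x. (cmod (g x))\<^sup>2)}"

definition L2_norm :: "'a measure \<Rightarrow> ('a \<Rightarrow> complex) \<Rightarrow> real" where
  "L2_norm M g = sqrt (\<integral>x. (cmod (g x))\<^sup>2 \<partial>M)"

definition L2_inner :: "'a measure \<Rightarrow> ('a \<Rightarrow> complex) \<Rightarrow> ('a \<Rightarrow> complex) \<Rightarrow> complex" where
  "L2_inner M g h = (\<integral>x. g x * cnj (h x) \<partial>M)"

text \<open>Coherence constraint mu(phi_1,...,phi_r) <= m, i.e. the maximum over p \<noteq> q of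
|<phi_p, phi_q>| is at most m (vacuous for r = 1).\<close>

definition coherence_le :: "'a measure \<Rightarrow> nat \<Rightarrow> (nat \<Rightarrow> 'a \<Rightarrow> complex) \<Rightarrow> real \<Rightarrow> bool" where
  "coherence_le M r phi m \<longleftrightarrow>
     (\<forall>p<r. \<forall>q<r. p \<noteq> q \<longrightarrow> cmod (L2_inner M (phi p) (phi q)) \<le> m)"

definition tensor :: "nat \<Rightarrow> (nat \<Rightarrow> 'a \<Rightarrow> complex) \<Rightarrow> (nat \<Rightarrow> 'a) \<Rightarrow> complex" where
  "tensor d phi = (\<lambda>x. \<Prod>k<d. phi k (x k))"

definition admissible ::
  "nat \<Rightarrow> (nat \<Rightarrow> 'a measure) \<Rightarrow> nat \<Rightarrow> (nat \<Rightarrow> real) \<Rightarrow> (nat \<Rightarrow> nat \<Rightarrow> 'a \<Rightarrow> complex) \<Rightarrow> bool" where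
  "admissible d M r mu phi \<longleftrightarrow>
     (\<forall>k<d. (\<forall>p<r. phi k p \<in> L2 (M k) \<and> L2_norm (M k) (phi k p) = 1)
            \<and> coherence_le (M k) r (phi k) (mu k))"

definition approx_err ::
  "nat \<Rightarrow> (nat \<Rightarrow> 'a measure) \<Rightarrow> ((nat \<Rightarrow> 'a) \<Rightarrow> complex) \<Rightarrow> nat
     \<Rightarrow> (nat \<Rightarrow> complex) \<Rightarrow> (nat \<Rightarrow> nat \<Rightarrow> 'a \<Rightarrow> complex) \<Rightarrow> real" where
  "approx_err d M f r lam phi =
     L2_norm (PiM {..<d} M)
       (\<lambda>x. f x - (\<Sum>p<r. lam p * tensor d (\<lambda>k. phi k p) x))"

end

theory Submission
  imports Defs "HOL-Complex_Analysis.Great_Picard"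
begin

text \<open>Pairwise coherence bounds make the Gram form of the tensor products coercive, so the
coefficients of a minimising sequence are bounded, and after passing to a subsequence all factors
converge weakly, to \<open>y\<^sub>k\<^sub>p\<close> say, while their Gram matrices converge to some \<open>G\<^sub>k\<close>.  The weak limits
need be neither normalised nor sufficiently incoherent.  The deficit \<open>G\<^sub>k - Gram y\<^sub>k\<close> is positive
semidefinite and, if it is nonzero, then \<open>L\<^sup>2(X\<^sub>k)\<close> is infinite-dimensional; hence there are \<open>e\<^sub>k\<^sub>p\<close>
orthogonal to all \<open>y\<^sub>k\<^sub>q\<close> with Gram matrix equal to the deficit.  Both \<open>y\<^sub>k\<^sub>p + e\<^sub>k\<^sub>p\<close> and \<open>y\<^sub>k\<^sub>p - e\<^sub>k\<^sub>p\<close>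
then have Gram matrix \<open>G\<^sub>k\<close> and are admissible.  The norm of the approximant depends on the Gram
matrices only, and its correlation with \<open>f\<close> is affine in each factor, so a suitable choice of signs
makes the error at most the limit of the errors.\<close>

subsection \<open>Square-integrable functions\<close>

text \<open>The product of the bounds appears because the Gram matrix of the tensor products is the
  entrywise product of the Gram matrices of the modes: its diagonal is 1 and its off-diagonal
  entries are at most \<open>\<Prod>k<d. mu k\<close> in modulus. Diagonal dominance then gives the
  coercivity constant \<open>1 - (real r - 1) * (\<Prod>k<d. mu k)\<close>. Without such a bound,
  nearly parallel terms could have diverging coefficients that cancel. Norm and mutual inner
  products can both be lost in a weak limit, so renormalising each limit separately would not do;
  the whole deficit matrix of a mode has to be realised at once. A nonzero deficit means that some
  difference between a factor and its weak limit tends to zero weakly but not in norm, which cannot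
  happen in finite dimension. The added vectors are orthogonal to the weak limits of their own mode
  but not to \<open>f\<close>, so adding them may worsen the correlation; this is why signs are
  needed. A sign belongs to a mode \<open>k\<close> and is shared by all \<open>p\<close>, since
  signs depending on \<open>p\<close> could alter the Gram matrix.\<close>

lemma borel_measurable_cnj [measurable (raw)]:
  "g \<in> borel_measurable M \<Longrightarrow> (\<lambda>x. cnj (g x)) \<in> borel_measurable M"
  by (rule borel_measurable_continuous_on) (intro continuous_intros)

lemma integrable_mult_cnj:
  assumes "g \<in> L2 M" "h \<in> L2 M"
  shows "integrable M (\<lambda>x. g x * cnj (h x))"
proof (rule Bochner_Integration.integrable_bound)
  have [measurable]: "g \<in> borel_measurable M" "h \<in> borel_measurable M"
    using assms by (auto simp: L2_def)
  show "integrable M (\<lambda>x. (cmod (g x))\<^sup>2 + (cmod (h x))\<^sup>2)"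
    using assms by (auto simp: L2_def)
  show "(\<lambda>x. g x * cnj (h x)) \<in> borel_measurable M"
    by measurable
  have "cmod (g x * cnj (h x)) \<le> (cmod (g x))\<^sup>2 + (cmod (h x))\<^sup>2" for x
    using sum_squares_bound[of "cmod (g x)" "cmod (h x)"]
      mult_nonneg_nonneg[OF norm_ge_zero norm_ge_zero, of "g x" "h x"]
    unfolding norm_mult complex_mod_cnj by linarith
  then show "AE x in M. norm (g x * cnj (h x)) \<le> norm ((cmod (g x))\<^sup>2 + (cmod (h x))\<^sup>2)"
    by simp
qed

lemma L2_zero [simp]: "(\<lambda>x. 0) \<in> L2 M"
  by (simp add: L2_def)

lemma L2_scale [intro]: "g \<in> L2 M \<Longrightarrow> (\<lambda>x. c * g x) \<in> L2 M"
  by (auto simp: L2_def norm_mult power_mult_distrib)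

lemma L2_add [intro]:
  assumes "g \<in> L2 M" "h \<in> L2 M"
  shows "(\<lambda>x. g x + h x) \<in> L2 M"
proof -
  have [measurable]: "g \<in> borel_measurable M" "h \<in> borel_measurable M"
    using assms by (auto simp: L2_def)
  have "integrable M (\<lambda>x. (cmod (g x))\<^sup>2 + (cmod (h x))\<^sup>2 + 2 * Re (g x * cnj (h x)))"
    using assms by (intro Bochner_Integration.integrable_add integrable_mult_right integrable_Re
      integrable_mult_cnj) (auto simp: L2_def)
  moreover have "(cmod (a + b))\<^sup>2 = (cmod a)\<^sup>2 + (cmod b)\<^sup>2 + 2 * Re (a * cnj b)" for a b
    unfolding cmod_power2 by (simp add: power2_eq_square algebra_simps)
  ultimately show ?thesis
    by (simp add: L2_def)
qed

lemma L2_diff [intro]: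
  assumes "g \<in> L2 M" "h \<in> L2 M"
  shows "(\<lambda>x. g x - h x) \<in> L2 M"
  using L2_add[OF assms(1) L2_scale[OF assms(2), of "-1"]] by simp

lemma L2_sum [intro]:
  assumes "\<And>i. i \<in> I \<Longrightarrow> g i \<in> L2 M"
  shows "(\<lambda>x. \<Sum>i\<in>I. g i x) \<in> L2 M"
  using assms by (induction I rule: infinite_finite_induct) auto

lemma L2_inner_add_left:
  "g \<in> L2 M \<Longrightarrow> h \<in> L2 M \<Longrightarrow> k \<in> L2 M \<Longrightarrow>
    L2_inner M (\<lambda>x. g x + h x) k = L2_inner M g k + L2_inner M h k"
  unfolding L2_inner_def distrib_right
  by (intro Bochner_Integration.integral_add integrable_mult_cnj)

lemma L2_inner_scale_left: "L2_inner M (\<lambda>x. c * g x) k = c * L2_inner M g k"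
  unfolding L2_inner_def mult.assoc by (rule integral_mult_right_zero)

lemma L2_inner_zero_left [simp]: "L2_inner M (\<lambda>x. 0) k = 0"
  by (simp add: L2_inner_def)

lemma L2_inner_cnj: "cnj (L2_inner M g h) = L2_inner M h g"
  unfolding L2_inner_def by (subst Bochner_Integration.integral_cnj[symmetric]) (simp add: mult.commute)

lemma L2_inner_diff_left:
  "g \<in> L2 M \<Longrightarrow> h \<in> L2 M \<Longrightarrow> k \<in> L2 M \<Longrightarrow>
    L2_inner M (\<lambda>x. g x - h x) k = L2_inner M g k - L2_inner M h k"
  unfolding L2_inner_def left_diff_distrib
  by (intro Bochner_Integration.integral_diff integrable_mult_cnj)

lemma L2_inner_sum_left:
  assumes "\<And>i. i \<in> I \<Longrightarrow> g i \<in> L2 M" "k \<in> L2 M"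
  shows "L2_inner M (\<lambda>x. \<Sum>i\<in>I. g i x) k = (\<Sum>i\<in>I. L2_inner M (g i) k)"
  using assms(1)
  by (induction I rule: infinite_finite_induct) (auto simp: L2_inner_add_left L2_sum assms(2))

lemma L2_inner_add_right:
  "g \<in> L2 M \<Longrightarrow> h \<in> L2 M \<Longrightarrow> k \<in> L2 M \<Longrightarrow>
    L2_inner M k (\<lambda>x. g x + h x) = L2_inner M k g + L2_inner M k h"
  by (subst (1 2 3) L2_inner_cnj[symmetric]) (simp add: L2_inner_add_left)

lemma L2_inner_diff_right:
  "g \<in> L2 M \<Longrightarrow> h \<in> L2 M \<Longrightarrow> k \<in> L2 M \<Longrightarrow>
    L2_inner M k (\<lambda>x. g x - h x) = L2_inner M k g - L2_inner M k h"
  by (subst (1 2 3) L2_inner_cnj[symmetric]) (simp add: L2_inner_diff_left)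

lemma L2_inner_scale_right: "L2_inner M k (\<lambda>x. c * g x) = cnj c * L2_inner M k g"
  by (subst (1 2) L2_inner_cnj[symmetric]) (simp add: L2_inner_scale_left)

lemma L2_inner_zero_right [simp]: "L2_inner M k (\<lambda>x. 0) = 0"
  by (simp add: L2_inner_def)

lemma L2_inner_sum_right:
  assumes "\<And>i. i \<in> I \<Longrightarrow> g i \<in> L2 M" "k \<in> L2 M"
  shows "L2_inner M k (\<lambda>x. \<Sum>i\<in>I. g i x) = (\<Sum>i\<in>I. L2_inner M k (g i))"
  using assms(1)
  by (induction I rule: infinite_finite_induct) (auto simp: L2_inner_add_right L2_sum assms(2))

lemmas L2_inner_linear =
  L2_inner_add_left L2_inner_add_right L2_inner_diff_left L2_inner_diff_right
  L2_inner_scale_left L2_inner_scale_right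

lemma L2_norm_nonneg [simp]: "0 \<le> L2_norm M g"
  by (simp add: L2_norm_def)

lemma L2_norm_squared: "(L2_norm M g)\<^sup>2 = (\<integral>x. (cmod (g x))\<^sup>2 \<partial>M)"
  by (simp add: L2_norm_def)

lemma L2_inner_self: "L2_inner M g g = complex_of_real ((L2_norm M g)\<^sup>2)"
  unfolding L2_norm_squared L2_inner_def
  by (simp only: complex_norm_square[symmetric] integral_complex_of_real)

lemma L2_norm_scale: "L2_norm M (\<lambda>x. c * g x) = cmod c * L2_norm M g"
  by (simp add: L2_norm_def norm_mult power_mult_distrib real_sqrt_mult)

lemma L2_norm_diff_squared:
  assumes "g \<in> L2 M" "h \<in> L2 M"
  shows "(L2_norm M (\<lambda>x. g x - h x))\<^sup>2
    = (L2_norm M g)\<^sup>2 - 2 * Re (L2_inner M g h) + (L2_norm M h)\<^sup>2"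
proof -
  have "complex_of_real ((L2_norm M (\<lambda>x. g x - h x))\<^sup>2)
    = complex_of_real ((L2_norm M g)\<^sup>2) - (L2_inner M g h + cnj (L2_inner M g h))
      + complex_of_real ((L2_norm M h)\<^sup>2)"
    unfolding L2_inner_self[symmetric] L2_inner_cnj
    using assms by (simp add: L2_inner_linear L2_diff algebra_simps)
  then show ?thesis
    unfolding complex_add_cnj by (simp only: of_real_diff[symmetric] of_real_add[symmetric] of_real_eq_iff)
qed

lemma L2_Cauchy_Schwarz:
  assumes "g \<in> L2 M" "h \<in> L2 M"
  shows "cmod (L2_inner M g h) \<le> L2_norm M g * L2_norm M h"
proof -
  define z where "z = L2_inner M g h"
  define a b where "a = (L2_norm M g)\<^sup>2" and "b = (L2_norm M h)\<^sup>2"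
  \<comment> \<open>Including \<open>z\<close> in the multiplier aligns the phases and leaves a
    quadratic in the real \<open>t\<close>. Its minimiser \<open>1 / b\<close> gives the claim; for
    \<open>b = 0\<close> it is linear in \<open>t\<close>, and the value of \<open>t\<close> used
    below would make it equal to -1.\<close>
  have ineq: "0 \<le> a - 2 * t * (cmod z)\<^sup>2 + t\<^sup>2 * (cmod z)\<^sup>2 * b" for t :: real
  proof -
    have "0 \<le> (L2_norm M (\<lambda>x. g x - (of_real t * z) * h x))\<^sup>2"
      by simp
    also have "\<dots> = a - 2 * Re (cnj (of_real t * z) * z) + (cmod (of_real t * z))\<^sup>2 * b"
      using assms by (simp add: L2_norm_diff_squared L2_scale L2_inner_scale_right L2_norm_scale
        z_def a_def b_def power_mult_distrib)
    also have "Re (cnj (of_real t * z) * z) = t * (cmod z)\<^sup>2"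
      unfolding cmod_power2 by (simp add: power2_eq_square algebra_simps)
    finally show ?thesis
      by (simp add: norm_mult power_mult_distrib)
  qed
  have "(cmod z)\<^sup>2 \<le> a * b"
  proof (cases "b = 0")
    case True
    show ?thesis
    proof (rule ccontr)
      assume "\<not> ?thesis"
      then have "0 < (cmod z)\<^sup>2" using True by simp
      then show False
        using ineq[of "(a + 1) / (2 * (cmod z)\<^sup>2)"] True by simp
    qed
  next
    case False
    then have "0 < b" by (simp add: b_def)
    have "0 \<le> b * (a - 2 * (1 / b) * (cmod z)\<^sup>2 + (1 / b)\<^sup>2 * (cmod z)\<^sup>2 * b)"
      using ineq[of "1 / b"] \<open>0 < b\<close> by simp
    also have "\<dots> = a * b - (cmod z)\<^sup>2"
      using \<open>0 < b\<close> by (simp add: field_simps power2_eq_square)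
    finally show ?thesis by simp
  qed
  then have "(cmod z)\<^sup>2 \<le> (L2_norm M g * L2_norm M h)\<^sup>2"
    by (simp add: a_def b_def power_mult_distrib)
  then show ?thesis
    unfolding z_def by (rule power2_le_imp_le) simp
qed

lemma L2_norm_add_le:
  assumes "g \<in> L2 M" "h \<in> L2 M"
  shows "L2_norm M (\<lambda>x. g x + h x) \<le> L2_norm M g + L2_norm M h"
proof (rule power2_le_imp_le)
  have "(L2_norm M (\<lambda>x. g x - (-1) * h x))\<^sup>2
      = (L2_norm M g)\<^sup>2 + 2 * Re (L2_inner M g h) + (L2_norm M h)\<^sup>2"
    using L2_norm_diff_squared[OF assms(1) L2_scale[OF assms(2), of "-1"]] L2_norm_scale[of M "-1" h]
    by (simp add: L2_inner_scale_right[of M g "-1", simplified])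
  also have "\<dots> \<le> (L2_norm M g)\<^sup>2 + 2 * (L2_norm M g * L2_norm M h) + (L2_norm M h)\<^sup>2"
    using complex_Re_le_cmod[of "L2_inner M g h"] L2_Cauchy_Schwarz[OF assms] by linarith
  finally show "(L2_norm M (\<lambda>x. g x + h x))\<^sup>2 \<le> (L2_norm M g + L2_norm M h)\<^sup>2"
    by (simp add: power2_sum)
qed simp

lemma L2_norm_diff_commute: "L2_norm M (\<lambda>x. g x - h x) = L2_norm M (\<lambda>x. h x - g x)"
  by (simp add: L2_norm_def norm_minus_commute)

lemma nn_integral_cmod_squared:
  assumes "g \<in> L2 M"
  shows "(\<integral>\<^sup>+x. ennreal ((cmod (g x))\<^sup>2) \<partial>M) = ennreal ((L2_norm M g)\<^sup>2)"
  unfolding L2_norm_squared using assms by (intro nn_integral_eq_integral) (auto simp: L2_def)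

text \<open>Riesz-Fischer: a rapidly Cauchy subsequence converges almost everywhere, and Fatou's
  lemma makes its pointwise limit the norm limit of the whole sequence.\<close>

lemma L2_complete:
  assumes x: "\<And>n. x n \<in> L2 M"
    and cauchy: "\<And>e. 0 < e \<Longrightarrow> \<exists>N. \<forall>m\<ge>N. \<forall>n\<ge>N. L2_norm M (\<lambda>t. x m t - x n t) < e"
  shows "\<exists>y\<in>L2 M. (\<lambda>n. L2_norm M (\<lambda>t. x n t - y t)) \<longlonglongrightarrow> 0"
proof -
  have [measurable]: "x n \<in> borel_measurable M" for n
    using x by (simp add: L2_def)
  have "\<exists>s. strict_mono s \<and> (\<forall>n. \<forall>m\<ge>s n. L2_norm M (\<lambda>t. x m t - x (s n) t) < sqrt ((1/8) ^ n))"
  proof -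
    have "\<forall>n. \<exists>N. \<forall>m\<ge>N. \<forall>n'\<ge>N. L2_norm M (\<lambda>t. x m t - x n' t) < sqrt ((1/8) ^ n)"
      using cauchy by simp
    then obtain N where N: "\<And>n m n'. m \<ge> N n \<Longrightarrow> n' \<ge> N n \<Longrightarrow>
        L2_norm M (\<lambda>t. x m t - x n' t) < sqrt ((1/8) ^ n)"
      by metis
    define s where "s = rec_nat (N 0) (\<lambda>n v. Suc (max v (N (Suc n))))"
    have s_Suc: "s (Suc n) = Suc (max (s n) (N (Suc n)))" for n by (simp add: s_def)
    have "strict_mono s" by (simp add: strict_mono_Suc_iff s_Suc less_Suc_eq_le)
    moreover have "N n \<le> s n" for n by (cases n) (auto simp: s_def)
    ultimately show ?thesis using N by (intro exI[of _ s]) (meson order_trans)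
  qed
  then obtain s where s: "strict_mono s"
    and s_close: "\<And>n m. m \<ge> s n \<Longrightarrow> L2_norm M (\<lambda>t. x m t - x (s n) t) < sqrt ((1/8) ^ n)"
    by blast
  \<comment> \<open>The squared norms of the increments are at most \<open>(1/8) ^ n\<close>. The
    weight \<open>4 ^ n\<close> leaves \<open>(1/2) ^ n\<close> for the sum of the integrals and
    still forces \<open>D n t\<close> to decay like \<open>(1/2) ^ n\<close> almost everywhere, so
    the telescoping sum converges.\<close>
  define D where "D n t = x (s (Suc n)) t - x (s n) t" for n t
  have [measurable]: "D n \<in> borel_measurable M" for n unfolding D_def by measurable
  have D_int: "(\<integral>\<^sup>+t. ennreal ((cmod (D n t))\<^sup>2) \<partial>M) \<le> ennreal ((1/8) ^ n)" for n
  proof -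
    have "(L2_norm M (D n))\<^sup>2 \<le> (sqrt ((1/8) ^ n))\<^sup>2"
      using s_close[of n "s (Suc n)"] s unfolding D_def
      by (intro power_mono) (auto simp: strict_mono_less_eq)
    then show ?thesis
      using x by (subst nn_integral_cmod_squared) (auto simp: D_def[abs_def] intro!: ennreal_leI)
  qed
  have "(\<integral>\<^sup>+t. (\<Sum>n. ennreal (4 ^ n * (cmod (D n t))\<^sup>2)) \<partial>M)
      = (\<Sum>n. \<integral>\<^sup>+t. ennreal (4 ^ n * (cmod (D n t))\<^sup>2) \<partial>M)"
    by (intro nn_integral_suminf) simp
  also have "\<dots> = (\<Sum>n. ennreal (4 ^ n) * (\<integral>\<^sup>+t. ennreal ((cmod (D n t))\<^sup>2) \<partial>M))"
    by (simp add: ennreal_mult' nn_integral_cmult)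
  also have "\<dots> \<le> (\<Sum>n. ennreal ((1/2) ^ n))"
  proof (intro suminf_le allI summableI)
    fix n
    have "ennreal (4 ^ n) * (\<integral>\<^sup>+t. ennreal ((cmod (D n t))\<^sup>2) \<partial>M) \<le> ennreal (4 ^ n) * ennreal ((1/8) ^ n)"
      by (intro mult_left_mono D_int) simp
    also have "\<dots> = ennreal ((1/2) ^ n)"
      by (simp add: ennreal_mult'[symmetric] power_mult_distrib[symmetric])
    finally show "ennreal (4 ^ n) * (\<integral>\<^sup>+t. ennreal ((cmod (D n t))\<^sup>2) \<partial>M) \<le> ennreal ((1/2) ^ n)" .
  qed
  also have "\<dots> = ennreal (\<Sum>n. (1/2) ^ n)"
    by (intro suminf_ennreal2) (auto intro: summable_geometric)
  finally have "(\<integral>\<^sup>+t. (\<Sum>n. ennreal (4 ^ n * (cmod (D n t))\<^sup>2)) \<partial>M) \<noteq> \<infinity>"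
    by (auto simp: top_unique)
  then have "AE t in M. (\<Sum>n. ennreal (4 ^ n * (cmod (D n t))\<^sup>2)) \<noteq> \<infinity>"
    by (intro nn_integral_PInf_AE) measurable
  moreover have "convergent (\<lambda>n. x (s n) t)" if "(\<Sum>n. ennreal (4 ^ n * (cmod (D n t))\<^sup>2)) \<noteq> \<infinity>" for t
  proof -
    define C where "C = enn2real (\<Sum>n. ennreal (4 ^ n * (cmod (D n t))\<^sup>2))"
    have C: "(\<Sum>n. ennreal (4 ^ n * (cmod (D n t))\<^sup>2)) = ennreal C"
      using that by (simp add: C_def less_top)
    have bound: "cmod (D n t) \<le> sqrt C * (1/2) ^ n" for n
    proof -
      have "ennreal (4 ^ n * (cmod (D n t))\<^sup>2) = (\<Sum>i\<in>{n}. ennreal (4 ^ i * (cmod (D i t))\<^sup>2))"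
        by simp
      also have "\<dots> \<le> ennreal C"
        unfolding C[symmetric] by (rule sum_le_suminf) (auto intro: summableI)
      finally have "4 ^ n * (cmod (D n t))\<^sup>2 \<le> C"
        by (simp add: C_def)
      moreover have "(4::real) ^ n = (2 ^ n)\<^sup>2" by (simp add: power_mult[symmetric] power_even_eq power2_eq_square power_mult_distrib[symmetric])
      ultimately have "(2 ^ n * cmod (D n t))\<^sup>2 \<le> C" by (simp add: power_mult_distrib)
      then have "2 ^ n * cmod (D n t) \<le> sqrt C" by (rule real_le_rsqrt)
      then show ?thesis by (simp add: field_simps power_divide)
    qed
    have "summable (\<lambda>n. D n t)"
    proof (rule summable_comparison_test')
      show "summable (\<lambda>n. sqrt C * (1/2) ^ n)" by (intro summable_mult summable_geometric) simp
    qed (use bound in auto)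
    then have "convergent (\<lambda>n. \<Sum>i<n. D i t)" by (simp add: summable_iff_convergent)
    moreover have "(\<Sum>i<n. D i t) = x (s n) t - x (s 0) t" for n
      unfolding D_def by (rule sum_lessThan_telescope)
    ultimately have "convergent (\<lambda>n. x (s n) t - x (s 0) t)" by simp
    from convergent_add[OF this convergent_const[of "x (s 0) t"]] show ?thesis by simp
  qed
  ultimately have AE_conv: "AE t in M. convergent (\<lambda>n. x (s n) t)" by auto
  \<comment> \<open>\<open>lim\<close> has an arbitrary value where the subsequence diverges, which
    happens only on a null set.\<close>
  define y where "y t = lim (\<lambda>n. x (s n) t)" for t
  have [measurable]: "y \<in> borel_measurable M" unfolding y_def by measurable
  have AE_lim: "AE t in M. (\<lambda>n. x (s n) t) \<longlonglongrightarrow> y t"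
    using AE_conv by eventually_elim (simp add: y_def convergent_LIMSEQ_iff)
  \<comment> \<open>Pointwise convergence is known along \<open>s\<close> only, so the Cauchy bound
    is applied to the indices \<open>s n\<close> and then passes to \<open>y\<close>.\<close>
  have fatou: "(\<integral>\<^sup>+t. ennreal ((cmod (x m t - y t))\<^sup>2) \<partial>M) \<le> ennreal (e\<^sup>2)"
    if e: "\<And>n. n \<ge> N \<Longrightarrow> L2_norm M (\<lambda>t. x m t - x n t) < e" for e m N
  proof -
    have "(\<integral>\<^sup>+t. ennreal ((cmod (x m t - y t))\<^sup>2) \<partial>M)
      = (\<integral>\<^sup>+t. liminf (\<lambda>n. ennreal ((cmod (x m t - x (s n) t))\<^sup>2)) \<partial>M)"
    proof (rule nn_integral_cong_AE, use AE_lim in eventually_elim)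
      case (elim t)
      then have "(\<lambda>n. ennreal ((cmod (x m t - x (s n) t))\<^sup>2)) \<longlonglongrightarrow> ennreal ((cmod (x m t - y t))\<^sup>2)"
        by (intro tendsto_intros)
      then show ?case by (intro lim_imp_Liminf[symmetric]) simp_all
    qed
    also have "\<dots> \<le> liminf (\<lambda>n. \<integral>\<^sup>+t. ennreal ((cmod (x m t - x (s n) t))\<^sup>2) \<partial>M)"
      by (intro nn_integral_liminf) measurable
    also have "\<dots> \<le> liminf (\<lambda>n. ennreal (e\<^sup>2))"
    proof (rule Liminf_mono, rule eventually_sequentiallyI)
      fix n assume "N \<le> n"
      then have "N \<le> s n" using seq_suble[OF s, of n] by simp
      then show "(\<integral>\<^sup>+t. ennreal ((cmod (x m t - x (s n) t))\<^sup>2) \<partial>M) \<le> ennreal (e\<^sup>2)"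
        using x e[of "s n"] by (subst nn_integral_cmod_squared) (auto intro!: ennreal_leI power_mono)
    qed
    finally show ?thesis by (simp add: Liminf_const)
  qed
  have diff_L2: "(\<lambda>t. x m t - y t) \<in> L2 M \<and> L2_norm M (\<lambda>t. x m t - y t) \<le> e"
    if "\<And>n. n \<ge> N \<Longrightarrow> L2_norm M (\<lambda>t. x m t - x n t) < e" for e m N
  proof -
    have le: "(\<integral>\<^sup>+t. ennreal ((cmod (x m t - y t))\<^sup>2) \<partial>M) \<le> ennreal (e\<^sup>2)"
      by (rule fatou) (rule that)
    then have L: "(\<lambda>t. x m t - y t) \<in> L2 M"
      by (auto simp: L2_def integrable_iff_bounded intro: le_less_trans)
    have "0 \<le> e" using that[of N] L2_norm_nonneg[of M "\<lambda>t. x m t - x N t"] by linarith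
    have "(L2_norm M (\<lambda>t. x m t - y t))\<^sup>2 \<le> e\<^sup>2"
      using le unfolding nn_integral_cmod_squared[OF L] by simp
    with L \<open>0 \<le> e\<close> show ?thesis by (auto intro: power2_le_imp_le)
  qed
  obtain N where "\<forall>m\<ge>N. \<forall>n\<ge>N. L2_norm M (\<lambda>t. x m t - x n t) < 1"
    using cauchy[of 1] by auto
  then have "(\<lambda>t. x N t - y t) \<in> L2 M"
    using diff_L2[of N N 1] by simp
  then have "(\<lambda>t. x N t - (x N t - y t)) \<in> L2 M" by (rule L2_diff[OF x])
  then have "y \<in> L2 M" by simp
  moreover have "(\<lambda>n. L2_norm M (\<lambda>t. x n t - y t)) \<longlonglongrightarrow> 0"
  proof (rule LIMSEQ_I)
    fix e :: real assume "0 < e"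
    then obtain N where N: "\<forall>m\<ge>N. \<forall>n\<ge>N. L2_norm M (\<lambda>t. x m t - x n t) < e / 2"
      using cauchy[of "e / 2"] by auto
    have "L2_norm M (\<lambda>t. x m t - y t) \<le> e / 2" if "m \<ge> N" for m
      using diff_L2[of N m "e / 2"] N that by simp
    with \<open>0 < e\<close> show "\<exists>N. \<forall>n\<ge>N. norm (L2_norm M (\<lambda>t. x n t - y t) - 0) < e"
      by (intro exI[of _ N]) fastforce
  qed
  ultimately show ?thesis by blast
qed

subsection \<open>Weak sequential compactness\<close>

text \<open>Closure under midpoints is all that the parallelogram argument needs of convexity.\<close>

inductive_set tail_hull :: "(nat \<Rightarrow> 'a \<Rightarrow> complex) \<Rightarrow> nat \<Rightarrow> ('a \<Rightarrow> complex) set"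
  for x m where
    point: "m \<le> n \<Longrightarrow> x n \<in> tail_hull x m"
  | midpoint: "g \<in> tail_hull x m \<Longrightarrow> h \<in> tail_hull x m \<Longrightarrow> (\<lambda>t. (1/2) * (g t + h t)) \<in> tail_hull x m"

lemma tail_hull_antimono:
  assumes "m \<le> n" shows "tail_hull x n \<subseteq> tail_hull x m"
proof
  fix g assume "g \<in> tail_hull x n"
  then show "g \<in> tail_hull x m"
    by induction (use assms in \<open>blast intro: tail_hull.intros order_trans\<close>)+
qed

lemma tail_hull_L2:
  assumes "g \<in> tail_hull x m" "\<And>n. x n \<in> L2 M" "\<And>n. L2_norm M (x n) \<le> B"
  shows "g \<in> L2 M" "L2_norm M g \<le> B"
proof -
  from assms(1) have "g \<in> L2 M \<and> L2_norm M g \<le> B"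
  proof induction
    case (point n)
    then show ?case using assms by simp
  next
    case (midpoint g h)
    then have "L2_norm M (\<lambda>t. (1/2) * (g t + h t)) \<le> 1/2 * (L2_norm M g + L2_norm M h)"
      unfolding L2_norm_scale using L2_norm_add_le[of g M h] by simp
    also have "\<dots> \<le> B" using midpoint by simp
    finally show ?case using midpoint by (intro conjI L2_scale L2_add) simp_all
  qed
  then show "g \<in> L2 M" "L2_norm M g \<le> B" by auto
qed

text \<open>Discs in the plane are closed under midpoints. Limits of inner products along
  \<open>x\<close> are thereby inherited by any sequence chosen from the hulls of its tails.\<close>

lemma tail_hull_inner_close:
  assumes "g \<in> tail_hull x m" "\<And>n. x n \<in> L2 M" "v \<in> L2 M"
    and "\<And>n. n \<ge> m \<Longrightarrow> cmod (L2_inner M (x n) v - a) \<le> e"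
  shows "cmod (L2_inner M g v - a) \<le> e"
proof -
  from assms(1) have "g \<in> L2 M \<and> cmod (L2_inner M g v - a) \<le> e"
  proof induction
    case (point n)
    then show ?case using assms by simp
  next
    case (midpoint g h)
    have "L2_inner M (\<lambda>t. (1/2) * (g t + h t)) v - a
        = 1/2 * ((L2_inner M g v - a) + (L2_inner M h v - a))"
      using midpoint assms(3) by (simp only: L2_inner_scale_left L2_inner_add_left) (simp add: field_simps)
    also have "cmod \<dots> \<le> 1/2 * (cmod (L2_inner M g v - a) + cmod (L2_inner M h v - a))"
      unfolding norm_mult using norm_triangle_ineq[of "L2_inner M g v - a" "L2_inner M h v - a"] by simp
    also have "\<dots> \<le> e" using midpoint by simp
    finally show ?case using midpoint by (intro conjI L2_scale L2_add) simp_all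
  qed
  then show ?thesis by simp
qed

lemma L2_parallelogram:
  assumes "g \<in> L2 M" "h \<in> L2 M"
  shows "(L2_norm M (\<lambda>t. g t - h t))\<^sup>2
    = 2 * (L2_norm M g)\<^sup>2 + 2 * (L2_norm M h)\<^sup>2 - 4 * (L2_norm M (\<lambda>t. (1/2) * (g t + h t)))\<^sup>2"
proof -
  have "complex_of_real ((L2_norm M (\<lambda>t. g t - h t))\<^sup>2)
    = complex_of_real (2 * (L2_norm M g)\<^sup>2 + 2 * (L2_norm M h)\<^sup>2 - (L2_norm M (\<lambda>t. g t + h t))\<^sup>2)"
    unfolding of_real_add of_real_diff of_real_mult L2_inner_self[symmetric]
    using assms by (simp add: L2_inner_linear L2_add L2_diff)
  then have "(L2_norm M (\<lambda>t. g t - h t))\<^sup>2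
    = 2 * (L2_norm M g)\<^sup>2 + 2 * (L2_norm M h)\<^sup>2 - (L2_norm M (\<lambda>t. g t + h t))\<^sup>2"
    by (simp only: of_real_eq_iff)
  then show ?thesis unfolding L2_norm_scale by (simp add: power_mult_distrib power_divide)
qed

lemma L2_inner_tendsto_left:
  assumes "\<And>n. y n \<in> L2 M" "z \<in> L2 M" "v \<in> L2 M"
    and "(\<lambda>n. L2_norm M (\<lambda>t. y n t - z t)) \<longlonglongrightarrow> 0"
  shows "(\<lambda>n. L2_inner M (y n) v) \<longlonglongrightarrow> L2_inner M z v"
proof -
  have "(\<lambda>n. L2_inner M (y n) v - L2_inner M z v) \<longlonglongrightarrow> 0"
  proof (rule Lim_null_comparison)
    show "(\<lambda>n. L2_norm M (\<lambda>t. y n t - z t) * L2_norm M v) \<longlonglongrightarrow> 0"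
      using tendsto_mult_right[OF assms(4), of "L2_norm M v"] by simp
    show "\<forall>\<^sub>F n in sequentially. norm (L2_inner M (y n) v - L2_inner M z v)
        \<le> L2_norm M (\<lambda>t. y n t - z t) * L2_norm M v"
      using assms by (auto simp: L2_inner_diff_left[symmetric] intro!: L2_Cauchy_Schwarz always_eventually)
  qed
  then show ?thesis by (simp add: LIM_zero_iff)
qed

text \<open>The elements of almost minimal norm in the hulls of the tails form a Cauchy sequence.\<close>

lemma L2_bounded_weak_candidate:
  assumes x: "\<And>n. x n \<in> L2 M" and B: "\<And>n. L2_norm M (x n) \<le> B"
  shows "\<exists>y\<in>L2 M. \<forall>v\<in>L2 M. \<forall>a. (\<lambda>n. L2_inner M (x n) v) \<longlonglongrightarrow> a \<longrightarrow> L2_inner M y v = a"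
proof -
  define N2 where "N2 g = (L2_norm M g)\<^sup>2" for g
  define d where "d m = Inf (N2 ` tail_hull x m)" for m
  have ne: "tail_hull x m \<noteq> {}" for m by (auto intro: tail_hull.point)
  have bdd: "bdd_below (N2 ` tail_hull x m)" for m
    by (intro bdd_belowI[of _ 0]) (auto simp: N2_def)
  have d_le: "d m \<le> N2 g" if "g \<in> tail_hull x m" for m g
    unfolding d_def using that bdd by (intro cInf_lower) auto
  have "incseq d"
    unfolding d_def by (intro incseq_SucI cInf_superset_mono image_mono tail_hull_antimono bdd) (use ne in auto)
  have "d m \<le> B\<^sup>2" for m
  proof -
    have "d m \<le> N2 (x m)" by (intro d_le tail_hull.point) simp
    also have "\<dots> \<le> B\<^sup>2" unfolding N2_def by (intro power_mono B) simp
    finally show ?thesis .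
  qed
  with \<open>incseq d\<close> obtain D where D: "d \<longlonglongrightarrow> D" "\<And>m. d m \<le> D"
    using incseq_convergent[of d "B\<^sup>2"] by blast
  have "\<exists>g\<in>tail_hull x m. N2 g < d m + 1 / real (Suc m)" for m
  proof -
    have "\<exists>z\<in>N2 ` tail_hull x m. z < d m + 1 / real (Suc m)"
      unfolding d_def using ne bdd by (subst cInf_less_iff[symmetric]) auto
    then show ?thesis by auto
  qed
  then obtain y where y: "\<And>m. y m \<in> tail_hull x m" "\<And>m. N2 (y m) < d m + 1 / real (Suc m)"
    by metis
  have y_L2: "y m \<in> L2 M" for m using tail_hull_L2(1)[OF y(1) x B] .
  \<comment> \<open>Both \<open>y m\<close> and \<open>y n\<close> lie in the hull of the tail from
    \<open>m\<close>, hence so does their midpoint, whose squared norm is at least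
    \<open>d m\<close>. The parallelogram identity bounds the squared distance by the two excesses
    over \<open>d m\<close>, and \<open>d n \<le> D\<close>.\<close>
  have close: "N2 (\<lambda>t. y m t - y n t) \<le> 2 * (D - d m) + 4 / real (Suc m)" if "m \<le> n" for m n
  proof -
    have "y n \<in> tail_hull x m" using y(1) tail_hull_antimono[OF that] by blast
    then have "d m \<le> N2 (\<lambda>t. (1/2) * (y m t + y n t))"
      by (intro d_le tail_hull.midpoint y)
    moreover have "N2 (\<lambda>t. y m t - y n t)
        = 2 * N2 (y m) + 2 * N2 (y n) - 4 * N2 (\<lambda>t. (1/2) * (y m t + y n t))"
      unfolding N2_def by (rule L2_parallelogram[OF y_L2 y_L2])
    moreover have "1 / real (Suc n) \<le> 1 / real (Suc m)"
      using that by (intro divide_left_mono) auto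
    ultimately show ?thesis using y(2)[of m] y(2)[of n] D(2)[of n] by simp
  qed
  have lim0: "(\<lambda>m. 2 * (D - d m) + 4 / real (Suc m)) \<longlonglongrightarrow> 2 * (D - D) + 0"
    by (intro tendsto_intros D) (use lim_const_over_n[of "4::real"] LIMSEQ_Suc in blast)
  have "\<exists>N. \<forall>m\<ge>N. \<forall>n\<ge>N. L2_norm M (\<lambda>t. y m t - y n t) < e" if "0 < e" for e
  proof -
    have "\<forall>\<^sub>F m in sequentially. 2 * (D - d m) + 4 / real (Suc m) < e\<^sup>2"
      using order_tendstoD(2)[OF lim0, of "e\<^sup>2"] that by simp
    then obtain N where N: "\<And>m. m \<ge> N \<Longrightarrow> 2 * (D - d m) + 4 / real (Suc m) < e\<^sup>2"
      by (auto simp: eventually_sequentially)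
    have le: "L2_norm M (\<lambda>t. y m t - y n t) < e" if "N \<le> m" "m \<le> n" for m n
    proof (rule power2_less_imp_less)
      show "(L2_norm M (\<lambda>t. y m t - y n t))\<^sup>2 < e\<^sup>2"
        using close[OF that(2)] N[OF that(1)] by (simp add: N2_def)
    qed (use \<open>0 < e\<close> in simp)
    have "L2_norm M (\<lambda>t. y m t - y n t) < e" if "N \<le> m" "N \<le> n" for m n
      using le[of m n] le[of n m] that L2_norm_diff_commute[of M "y m" "y n"] by linarith
    then show ?thesis by blast
  qed
  then obtain z where z: "z \<in> L2 M" "(\<lambda>n. L2_norm M (\<lambda>t. y n t - z t)) \<longlonglongrightarrow> 0"
    using L2_complete[of y M] y_L2 by blast
  \<comment> \<open>The vector \<open>z\<close> is fixed before \<open>v\<close> and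
    \<open>a\<close>: it identifies every limit of inner products that happens to exist, without any
    claim yet that they all exist.\<close>
  have "L2_inner M z v = a" if v: "v \<in> L2 M" and a: "(\<lambda>n. L2_inner M (x n) v) \<longlonglongrightarrow> a" for v a
  proof (rule LIMSEQ_unique)
    show "(\<lambda>n. L2_inner M (y n) v) \<longlonglongrightarrow> L2_inner M z v"
      by (intro L2_inner_tendsto_left y_L2 z v)
    show "(\<lambda>n. L2_inner M (y n) v) \<longlonglongrightarrow> a"
    proof (rule LIMSEQ_I)
      fix e :: real assume "0 < e"
      then obtain N where N: "\<And>n. n \<ge> N \<Longrightarrow> cmod (L2_inner M (x n) v - a) < e / 2"
        using LIMSEQ_D[OF a, of "e / 2"] by auto
      have "cmod (L2_inner M (y n) v - a) \<le> e / 2" if "n \<ge> N" for n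
        by (rule tail_hull_inner_close[OF y(1) x v]) (use N that in \<open>force intro: less_imp_le\<close>)
      then show "\<exists>N. \<forall>n\<ge>N. norm (L2_inner M (y n) v - a) < e"
        using \<open>0 < e\<close> by (intro exI[of _ N]) fastforce
    qed
  qed
  with z(1) show ?thesis by blast
qed

definition L2_weakly :: "'a measure \<Rightarrow> (nat \<Rightarrow> 'a \<Rightarrow> complex) \<Rightarrow> ('a \<Rightarrow> complex) \<Rightarrow> bool" where
  "L2_weakly M x y \<longleftrightarrow> y \<in> L2 M \<and> (\<forall>v\<in>L2 M. (\<lambda>n. L2_inner M (x n) v) \<longlonglongrightarrow> L2_inner M y v)"

lemma L2_weakly_left: "L2_weakly M x y \<Longrightarrow> v \<in> L2 M \<Longrightarrow> (\<lambda>n. L2_inner M (x n) v) \<longlonglongrightarrow> L2_inner M y v"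
  by (simp add: L2_weakly_def)

lemma L2_weakly_right: "L2_weakly M x y \<Longrightarrow> v \<in> L2 M \<Longrightarrow> (\<lambda>n. L2_inner M v (x n)) \<longlonglongrightarrow> L2_inner M v y"
  using tendsto_cnj[OF L2_weakly_left, of M x y v] by (simp only: L2_inner_cnj)

text \<open>Testing against the members of the sequence suffices, which is a countable condition
  that a diagonal subsequence can meet. If convergence to the candidate \<open>y\<close> failed at
  some \<open>v\<close>, a subsequence would have another candidate \<open>y'\<close> disagreeing
  with \<open>y\<close> at \<open>v\<close>. Their difference is orthogonal to every
  \<open>x m\<close>, hence to both candidates, hence to itself.\<close>

lemma L2_weakly_convergent:
  assumes x: "\<And>n. x n \<in> L2 M" and B: "\<And>n. L2_norm M (x n) \<le> B"
    and conv: "\<And>m. convergent (\<lambda>n. L2_inner M (x n) (x m))"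
  shows "\<exists>y. L2_weakly M x y"
proof -
  obtain y where y1: "y \<in> L2 M"
    and y2: "\<forall>v\<in>L2 M. \<forall>a. (\<lambda>n. L2_inner M (x n) v) \<longlonglongrightarrow> a \<longrightarrow> L2_inner M y v = a"
    using L2_bounded_weak_candidate[of x M B, OF x B] by (elim bexE)
  note y = y1 y2[rule_format]
  have "(\<lambda>n. L2_inner M (x n) v) \<longlonglongrightarrow> L2_inner M y v" if v: "v \<in> L2 M" for v
  proof (rule ccontr)
    assume "\<not> ?thesis"
    then obtain e where e: "0 < e" "\<And>N. \<exists>n\<ge>N. e \<le> cmod (L2_inner M (x n) v - L2_inner M y v)"
      unfolding LIMSEQ_iff not_all not_ex not_imp not_less by auto
    then have "infinite {n. e \<le> cmod (L2_inner M (x n) v - L2_inner M y v)}"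
      unfolding infinite_nat_iff_unbounded_le by auto
    then obtain s :: "nat \<Rightarrow> nat" where s: "strict_mono s"
      "\<And>n. e \<le> cmod (L2_inner M (x (s n)) v - L2_inner M y v)"
      using infinite_enumerate[of "{n. e \<le> cmod (L2_inner M (x n) v - L2_inner M y v)}"] by blast
    have "bounded (range (\<lambda>n. L2_inner M (x (s n)) v))"
    proof (rule boundedI)
      fix z assume "z \<in> range (\<lambda>n. L2_inner M (x (s n)) v)"
      then show "norm z \<le> B * L2_norm M v"
        using L2_Cauchy_Schwarz[OF x v] mult_right_mono[OF B, of "L2_norm M v"]
        by (auto intro: order_trans)
    qed
    then obtain a u where u: "strict_mono u" and a: "((\<lambda>n. L2_inner M (x (s n)) v) \<circ> u) \<longlonglongrightarrow> a"
      using bounded_imp_convergent_subsequence by blast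
    obtain y' where y'1: "y' \<in> L2 M"
      and y'2: "\<forall>v\<in>L2 M. \<forall>a. (\<lambda>n. L2_inner M (x (s (u n))) v) \<longlonglongrightarrow> a \<longrightarrow> L2_inner M y' v = a"
      using L2_bounded_weak_candidate[of "\<lambda>n. x (s (u n))" M B, OF x B] by (elim bexE)
    note y' = y'1 y'2[rule_format]
    have su: "strict_mono (\<lambda>n. s (u n))" using s(1) u by (auto simp: strict_mono_def)
    define w where "w t = y t - y' t" for t
    have w: "w \<in> L2 M" unfolding w_def using y y' by (intro L2_diff)
    have orth: "L2_inner M (x m) w = 0" for m
    proof -
      obtain b where b: "(\<lambda>n. L2_inner M (x n) (x m)) \<longlonglongrightarrow> b"
        using conv unfolding convergent_def by blast
      then have "(\<lambda>n. L2_inner M (x (s (u n))) (x m)) \<longlonglongrightarrow> b"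
        using LIMSEQ_subseq_LIMSEQ[OF b su] by (simp add: o_def)
      then have "L2_inner M w (x m) = 0"
        unfolding w_def using y y' b x by (simp add: L2_inner_diff_left)
      then show ?thesis by (subst L2_inner_cnj[symmetric]) simp
    qed
    \<comment> \<open>The inner products of the sequence with \<open>w\<close> are constantly 0, so
      both candidates must reproduce the limit 0.\<close>
    have "L2_inner M y w = 0" by (rule y(2)[OF w]) (simp add: orth)
    moreover have "L2_inner M y' w = 0" by (rule y'(2)[OF w]) (simp add: orth)
    ultimately have "L2_inner M w w = 0"
      using L2_inner_diff_left[OF y(1) y'(1) w] by (simp add: w_def[abs_def])
    then have "L2_norm M w = 0" by (simp add: L2_inner_self)
    \<comment> \<open>Norm 0 makes \<open>w\<close> vanish only almost everywhere; Cauchy-Schwarz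
      turns this into the equality of inner products that is needed.\<close>
    then have "L2_inner M w v = 0" using L2_Cauchy_Schwarz[OF w v] by simp
    then have "L2_inner M y v = L2_inner M y' v"
      unfolding w_def using y y' v by (simp add: L2_inner_diff_left)
    also have "\<dots> = a" using y'(2)[OF v] a by (simp add: o_def)
    finally have "(\<lambda>n. L2_inner M (x (s (u n))) v) \<longlonglongrightarrow> L2_inner M y v"
      using a by (simp add: o_def)
    from LIMSEQ_D[OF this e(1)] obtain n where "cmod (L2_inner M (x (s (u n))) v - L2_inner M y v) < e"
      by blast
    with s(2)[of "u n"] show False by simp
  qed
  with y(1) show ?thesis unfolding L2_weakly_def by blast
qed

subsection \<open>Realising limits of Gram matrices\<close>

lemma L2_orthonormal_projection:
  assumes U: "finite U" "U \<subseteq> L2 M"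
    and on: "\<forall>u\<in>U. \<forall>v\<in>U. L2_inner M u v = (if u = v then 1 else 0)"
    and w: "w \<in> L2 M" and v: "v \<in> U"
  shows "L2_inner M (\<lambda>t. w t - (\<Sum>u\<in>U. L2_inner M w u * u t)) v = 0"
proof -
  have U_L2: "u \<in> L2 M" if "u \<in> U" for u using U that by blast
  have "L2_inner M (\<lambda>t. \<Sum>u\<in>U. L2_inner M w u * u t) v = (\<Sum>u\<in>U. L2_inner M w u * L2_inner M u v)"
    using v by (subst L2_inner_sum_left) (auto intro: L2_scale U_L2 simp: L2_inner_scale_left)
  also have "\<dots> = (\<Sum>u\<in>U. if u = v then L2_inner M w u else 0)"
    using on v by (intro sum.cong refl) auto
  also have "\<dots> = L2_inner M w v" using v U(1) by (simp add: sum.delta)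
  finally show ?thesis
    using w v by (simp add: L2_inner_diff_left L2_sum L2_scale U_L2)
qed

text \<open>Gram-Schmidt. The span condition is recorded in dual form, as the passage of
  orthogonality from \<open>U\<close> to \<open>W\<close>, which avoids linear combinations that
  agree only up to null sets.\<close>

lemma L2_orthonormalise:
  assumes "finite W" "W \<subseteq> L2 M"
  shows "\<exists>U. finite U \<and> U \<subseteq> L2 M \<and> (\<forall>u\<in>U. \<forall>v\<in>U. L2_inner M u v = (if u = v then 1 else 0))
    \<and> (\<forall>x\<in>L2 M. (\<forall>u\<in>U. L2_inner M x u = 0) \<longrightarrow> (\<forall>w\<in>W. L2_inner M x w = 0))"
  using assms
proof (induction W rule: finite_induct)
  case empty
  then show ?case by (intro exI[of _ "{}"]) auto
next
  case (insert w W)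
  then have "W \<subseteq> L2 M" by simp
  from insert.IH[OF this] obtain U where U: "finite U" "U \<subseteq> L2 M"
    and on': "\<forall>u\<in>U. \<forall>v\<in>U. L2_inner M u v = (if u = v then 1 else 0)"
    and UW: "\<forall>x\<in>L2 M. (\<forall>u\<in>U. L2_inner M x u = 0) \<longrightarrow> (\<forall>w\<in>W. L2_inner M x w = 0)"
    by (elim exE conjE)
  note on = on'[rule_format]
  have w: "w \<in> L2 M" using insert by simp
  have U_L2: "u \<in> L2 M" if "u \<in> U" for u using U that by blast
  define p where "p t = (\<Sum>u\<in>U. L2_inner M w u * u t)" for t
  define w' where "w' t = w t - p t" for t
  have p: "p \<in> L2 M" unfolding p_def[abs_def] by (intro L2_sum L2_scale U_L2)
  have w': "w' \<in> L2 M" unfolding w'_def[abs_def] by (intro L2_diff w p)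
  have orth: "L2_inner M w' v = 0" if "v \<in> U" for v
    unfolding w'_def[abs_def] p_def by (rule L2_orthonormal_projection[OF U on' w that])
  have xp: "L2_inner M x p = 0" if "x \<in> L2 M" "\<And>u. u \<in> U \<Longrightarrow> L2_inner M x u = 0" for x
    unfolding p_def[abs_def] using that
    by (subst L2_inner_sum_right) (auto intro: L2_scale U_L2 simp: L2_inner_scale_right)
  have xw: "L2_inner M x w = L2_inner M x w'" if "x \<in> L2 M" "\<And>u. u \<in> U \<Longrightarrow> L2_inner M x u = 0" for x
    unfolding w'_def[abs_def] using that xp w p by (simp add: L2_inner_diff_right)
  show ?case
  proof (cases "L2_norm M w' = 0")
    \<comment> \<open>Up to a null set \<open>w\<close> depends on \<open>U\<close> already, so
      nothing is added; its vanishing residual is orthogonal to everything by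
      Cauchy-Schwarz.\<close>
    case True
    have "L2_inner M x w = 0" if x: "x \<in> L2 M" "\<And>u. u \<in> U \<Longrightarrow> L2_inner M x u = 0" for x
      using L2_Cauchy_Schwarz[OF x(1) w'] True xw[OF x] by simp
    then show ?thesis using U on UW by (intro exI[of _ U]) auto
  next
    case False
    define c where "c = complex_of_real (1 / L2_norm M w')"
    define e where "e t = c * w' t" for t
    have e: "e \<in> L2 M" unfolding e_def[abs_def] by (intro L2_scale w')
    have ee: "L2_inner M e e = 1"
      unfolding e_def[abs_def] L2_inner_scale_left L2_inner_scale_right L2_inner_self c_def
      using False by (simp add: power2_eq_square)
    have eu: "L2_inner M e u = 0" if "u \<in> U" for u
      using orth[OF that] by (simp add: e_def[abs_def] L2_inner_scale_left)
    then have ue: "L2_inner M u e = 0" if "u \<in> U" for u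
      using that L2_inner_cnj[of M e u] by simp
    have "e \<notin> U" using ee eu by force
    have "L2_inner M x w = 0"
      if x: "x \<in> L2 M" "L2_inner M x e = 0" "\<forall>u\<in>U. L2_inner M x u = 0" for x
    proof -
      have "cnj c * L2_inner M x w' = 0" using x(2) by (simp add: e_def[abs_def] L2_inner_scale_right)
      then have "L2_inner M x w' = 0" using False by (simp add: c_def)
      then show ?thesis using xw[of x] x by simp
    qed
    with U e ee eu ue on UW \<open>e \<notin> U\<close> show ?thesis
      by (intro exI[of _ "insert e U"]) auto
  qed
qed

text \<open>A finite-dimensional space cannot hold the sequence: the coefficients along an
  orthonormal system for \<open>W\<close> tend to 0, while the squared norms tend to
  \<open>E > 0\<close>. Some member therefore has a nonzero residual, which is normalised. This is
  how a deficit certifies room for new orthogonal vectors.\<close>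

lemma L2_weakly_null_orthogonal_unit:
  assumes psi: "\<And>n. psi n \<in> L2 M" and null: "L2_weakly M psi (\<lambda>x. 0)"
    and lim: "(\<lambda>n. (L2_norm M (psi n))\<^sup>2) \<longlonglongrightarrow> E" and "0 < E"
    and W: "finite W" "W \<subseteq> L2 M"
  shows "\<exists>v\<in>L2 M. L2_inner M v v = 1 \<and> (\<forall>w\<in>W. L2_inner M v w = 0)"
proof -
  obtain U where U: "finite U" "U \<subseteq> L2 M"
    and on': "\<forall>u\<in>U. \<forall>v\<in>U. L2_inner M u v = (if u = v then 1 else 0)"
    and UW: "\<forall>x\<in>L2 M. (\<forall>u\<in>U. L2_inner M x u = 0) \<longrightarrow> (\<forall>w\<in>W. L2_inner M x w = 0)"
    using L2_orthonormalise[OF W] by (elim exE conjE)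
  have U_L2: "u \<in> L2 M" if "u \<in> U" for u using U that by blast
  have "(\<lambda>n. (L2_norm M (psi n))\<^sup>2 - (\<Sum>u\<in>U. (cmod (L2_inner M (psi n) u))\<^sup>2)) \<longlonglongrightarrow>
      E - (\<Sum>u\<in>U. (cmod (L2_inner M (\<lambda>x. 0) u))\<^sup>2)"
    by (intro tendsto_intros lim L2_weakly_left[OF null] U_L2)
  then have "\<forall>\<^sub>F n in sequentially. 0 < (L2_norm M (psi n))\<^sup>2 - (\<Sum>u\<in>U. (cmod (L2_inner M (psi n) u))\<^sup>2)"
    using \<open>0 < E\<close> by (intro order_tendstoD) auto
  then obtain n where n: "(\<Sum>u\<in>U. (cmod (L2_inner M (psi n) u))\<^sup>2) < (L2_norm M (psi n))\<^sup>2"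
    by (auto simp: eventually_sequentially)
  define p where "p t = (\<Sum>u\<in>U. L2_inner M (psi n) u * u t)" for t
  define w where "w t = psi n t - p t" for t
  have p: "p \<in> L2 M" unfolding p_def[abs_def] by (intro L2_sum L2_scale U_L2)
  have w: "w \<in> L2 M" unfolding w_def[abs_def] by (intro L2_diff psi p)
  have orth: "L2_inner M w v = 0" if "v \<in> U" for v
    unfolding w_def[abs_def] p_def by (rule L2_orthonormal_projection[OF U on' psi that])
  have inner_p: "L2_inner M x p = (\<Sum>u\<in>U. cnj (L2_inner M (psi n) u) * L2_inner M x u)" if "x \<in> L2 M" for x
    unfolding p_def[abs_def] using that
    by (subst L2_inner_sum_right) (auto intro: L2_scale U_L2 simp: L2_inner_scale_right)
  \<comment> \<open>A vanishing residual would turn Bessel's inequality for \<open>psi n\<close>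
    into an equality, contrary to the choice of \<open>n\<close>.\<close>
  have "L2_norm M w \<noteq> 0"
  proof
    assume "L2_norm M w = 0"
    then have "L2_inner M w (psi n) = 0" using L2_Cauchy_Schwarz[OF w psi, of n] by simp
    then have "L2_inner M (psi n) (psi n) = L2_inner M p (psi n)"
      unfolding w_def[abs_def] using psi p by (simp add: L2_inner_diff_left)
    then have "L2_inner M (psi n) (psi n) = L2_inner M (psi n) p"
      by (metis L2_inner_cnj)
    also have "\<dots> = complex_of_real (\<Sum>u\<in>U. (cmod (L2_inner M (psi n) u))\<^sup>2)"
      unfolding inner_p[OF psi] of_real_sum complex_norm_square by (simp add: mult.commute)
    finally show False using n unfolding L2_inner_self of_real_eq_iff by simp
  qed
  define v where "v t = complex_of_real (1 / L2_norm M w) * w t" for t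
  have "v \<in> L2 M" unfolding v_def[abs_def] by (intro L2_scale w)
  moreover have "L2_inner M v v = 1"
    unfolding v_def[abs_def] L2_inner_scale_left L2_inner_scale_right L2_inner_self
    using \<open>L2_norm M w \<noteq> 0\<close> by (simp add: power2_eq_square)
  moreover have "\<forall>u\<in>U. L2_inner M v u = 0"
    using orth unfolding v_def[abs_def] L2_inner_scale_left by simp
  ultimately show ?thesis using UW by blast
qed

text \<open>A Cholesky step on the limit Gram matrix: the last vector is split off and the others are
replaced by their Schur complements.  A nonzero pivot certifies that the space is large enough.\<close>

lemma L2_realise_limit_gram:
  fixes r :: nat
  assumes "\<And>n p. p < r \<Longrightarrow> psi n p \<in> L2 M"
    and "\<And>p. p < r \<Longrightarrow> L2_weakly M (\<lambda>n. psi n p) (\<lambda>x. 0)"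
    and "\<And>p q. p < r \<Longrightarrow> q < r \<Longrightarrow> (\<lambda>n. L2_inner M (psi n p) (psi n q)) \<longlonglongrightarrow> E p q"
    and "finite W" "W \<subseteq> L2 M"
  shows "\<exists>e. (\<forall>p<r. e p \<in> L2 M \<and> (\<forall>w\<in>W. L2_inner M (e p) w = 0))
    \<and> (\<forall>p<r. \<forall>q<r. L2_inner M (e p) (e q) = E p q)"
  using assms
proof (induction r arbitrary: psi E)
  case 0
  then show ?case by simp
next
  case (Suc r)
  note psi = Suc.prems(1) and null = Suc.prems(2) and gram = Suc.prems(3) and W = Suc.prems(4,5)
  have herm: "E p q = cnj (E q p)" if "p < Suc r" "q < Suc r" for p q
  proof (rule LIMSEQ_unique[OF gram[OF that]])
    show "(\<lambda>n. L2_inner M (psi n p) (psi n q)) \<longlonglongrightarrow> cnj (E q p)"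
      using tendsto_cnj[OF gram[OF that(2,1)]] by (simp only: L2_inner_cnj)
  qed
  have norm_lim: "(\<lambda>n. (L2_norm M (psi n r))\<^sup>2) \<longlonglongrightarrow> Re (E r r)"
    using tendsto_Re[OF gram[of r r]] by (simp add: L2_inner_self)
  have Err: "E r r = complex_of_real (Re (E r r))"
    using herm[of r r] by (simp add: complex_eq_iff)
  have "0 \<le> Re (E r r)" by (rule LIMSEQ_le_const[OF norm_lim]) auto
  show ?case
  proof (cases "E r r = 0")
    case True
    \<comment> \<open>With a zero pivot the vectors \<open>psi n r\<close> tend to 0 in norm, so row
      and column \<open>r\<close> of \<open>E\<close> vanish and the zero function can serve as the
      last vector.\<close>
    have zero: "E p r = 0" if "p < Suc r" for p
    proof (rule LIMSEQ_unique[OF gram[OF that, of r]])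
      show "(\<lambda>n. L2_inner M (psi n p) (psi n r)) \<longlonglongrightarrow> 0"
      proof (rule Lim_null_comparison)
        have "(\<lambda>n. sqrt ((L2_norm M (psi n p))\<^sup>2) * sqrt ((L2_norm M (psi n r))\<^sup>2))
            \<longlonglongrightarrow> sqrt (Re (E p p)) * sqrt (Re (E r r))"
          using tendsto_Re[OF gram[of p p]] that
          by (intro tendsto_intros norm_lim) (simp add: L2_inner_self)
        then show "(\<lambda>n. L2_norm M (psi n p) * L2_norm M (psi n r)) \<longlonglongrightarrow> 0"
          using True by simp
        show "\<forall>\<^sub>F n in sequentially. cmod (L2_inner M (psi n p) (psi n r))
            \<le> L2_norm M (psi n p) * L2_norm M (psi n r)"
          using psi that by (intro always_eventually allI L2_Cauchy_Schwarz) auto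
      qed
    qed simp
    have "\<exists>e. (\<forall>p<r. e p \<in> L2 M \<and> (\<forall>w\<in>W. L2_inner M (e p) w = 0))
        \<and> (\<forall>p<r. \<forall>q<r. L2_inner M (e p) (e q) = E p q)"
      by (rule Suc.IH[of psi]) (use psi null gram W in auto)
    then obtain e where e': "\<forall>p<r. e p \<in> L2 M \<and> (\<forall>w\<in>W. L2_inner M (e p) w = 0)"
      and e'': "\<forall>p<r. \<forall>q<r. L2_inner M (e p) (e q) = E p q"
      by (elim exE conjE)
    then have e: "\<And>p. p < r \<Longrightarrow> e p \<in> L2 M" "\<And>p w. p < r \<Longrightarrow> w \<in> W \<Longrightarrow> L2_inner M (e p) w = 0"
      "\<And>p q. p < r \<Longrightarrow> q < r \<Longrightarrow> L2_inner M (e p) (e q) = E p q"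
      by simp_all
    have zero': "E r p = 0" if "p < Suc r" for p
      using zero[OF that] herm[of r p] that by simp
    show ?thesis
      using e zero zero' by (intro exI[of _ "e(r := \<lambda>x. 0)"]) (auto simp: less_Suc_eq)
  next
    case False
    \<comment> \<open>\<open>c p\<close> is the elimination multiplier: \<open>psi'\<close> is
      asymptotically orthogonal to \<open>psi n r\<close>, and \<open>E'\<close> is the Schur
      complement of the pivot.\<close>
    define c where "c p = E p r / E r r" for p
    define psi' where "psi' n p = (\<lambda>t. psi n p t - c p * psi n r t)" for n p
    define E' where "E' p q = E p q - c p * E r q" for p q
    have "0 < Re (E r r)" using False Err \<open>0 \<le> Re (E r r)\<close> by (metis less_eq_real_def of_real_0)
    have cE: "c p * E r r = E p r" for p using False by (simp add: c_def)
    have Ec: "cnj (c q) * E r r = E r q" if "q < Suc r" for q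
      using herm[of q r] herm[of r q] herm[of r r] False that by (simp add: c_def)
    have "\<exists>e. (\<forall>p<r. e p \<in> L2 M \<and> (\<forall>w\<in>W. L2_inner M (e p) w = 0))
        \<and> (\<forall>p<r. \<forall>q<r. L2_inner M (e p) (e q) = E' p q)"
    proof (rule Suc.IH[of psi' E'])
      show "psi' n p \<in> L2 M" if "p < r" for n p
        unfolding psi'_def using that by (intro L2_diff L2_scale psi) auto
      show "L2_weakly M (\<lambda>n. psi' n p) (\<lambda>x. 0)" if "p < r" for p
      proof -
        have "(\<lambda>n. L2_inner M (psi' n p) v) \<longlonglongrightarrow> L2_inner M (\<lambda>x. 0) v" if v: "v \<in> L2 M" for v
        proof -
          have "(\<lambda>n. L2_inner M (psi n p) v - c p * L2_inner M (psi n r) v)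
              \<longlonglongrightarrow> L2_inner M (\<lambda>x. 0) v - c p * L2_inner M (\<lambda>x. 0) v"
            using \<open>p < r\<close> by (intro tendsto_intros L2_weakly_left[OF null] v) auto
          then show ?thesis
            using v psi \<open>p < r\<close> by (simp add: psi'_def L2_inner_linear L2_scale)
        qed
        then show ?thesis by (simp add: L2_weakly_def)
      qed
      show "(\<lambda>n. L2_inner M (psi' n p) (psi' n q)) \<longlonglongrightarrow> E' p q" if "p < r" "q < r" for p q
      proof -
        have "(\<lambda>n. L2_inner M (psi n p) (psi n q) - c p * L2_inner M (psi n r) (psi n q)
              - (cnj (c q) * (L2_inner M (psi n p) (psi n r) - c p * L2_inner M (psi n r) (psi n r))))
            \<longlonglongrightarrow> E p q - c p * E r q - (cnj (c q) * (E p r - c p * E r r))"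
          using that by (intro tendsto_intros gram) auto
        \<comment> \<open>The last bracket of the limit is 0 by \<open>cE\<close>, which leaves the
          one-sided formula for \<open>E'\<close>.\<close>
        then show ?thesis
          using psi that cE by (simp add: psi'_def E'_def L2_inner_linear L2_scale L2_diff algebra_simps)
      qed
    qed (use W in auto)
    then obtain e where e': "\<forall>p<r. e p \<in> L2 M \<and> (\<forall>w\<in>W. L2_inner M (e p) w = 0)"
      and e'': "\<forall>p<r. \<forall>q<r. L2_inner M (e p) (e q) = E' p q"
      by (elim exE conjE)
    then have e: "\<And>p. p < r \<Longrightarrow> e p \<in> L2 M" "\<And>p w. p < r \<Longrightarrow> w \<in> W \<Longrightarrow> L2_inner M (e p) w = 0"
      "\<And>p q. p < r \<Longrightarrow> q < r \<Longrightarrow> L2_inner M (e p) (e q) = E' p q"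
      by simp_all
    \<comment> \<open>The sequence \<open>psi n r\<close> has a positive limiting squared norm, so
      there is a unit direction orthogonal both to \<open>W\<close> and to the vectors already
      built.\<close>
    have "\<exists>v\<in>L2 M. L2_inner M v v = 1 \<and> (\<forall>w\<in>W \<union> e ` {..<r}. L2_inner M v w = 0)"
      by (rule L2_weakly_null_orthogonal_unit[OF _ null norm_lim \<open>0 < Re (E r r)\<close>])
        (use psi W e in auto)
    then obtain v where v: "v \<in> L2 M" "L2_inner M v v = 1" "\<And>w. w \<in> W \<Longrightarrow> L2_inner M v w = 0"
      "\<And>p. p < r \<Longrightarrow> L2_inner M v (e p) = 0"
      by auto
    have v': "L2_inner M (e p) v = 0" if "p < r" for p
      using v(4)[OF that] L2_inner_cnj[of M v "e p"] by simp
    define er where "er t = complex_of_real (sqrt (Re (E r r))) * v t" for t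
    have er: "er \<in> L2 M" unfolding er_def[abs_def] by (intro L2_scale v)
    have er_er: "L2_inner M er er = E r r"
      unfolding er_def[abs_def] L2_inner_scale_left L2_inner_scale_right v
      using \<open>0 < Re (E r r)\<close> by (subst Err) (simp add: of_real_mult[symmetric] del: of_real_mult)
    have er_w: "L2_inner M er w = 0" if "w \<in> W" for w
      unfolding er_def[abs_def] L2_inner_scale_left using v(3)[OF that] by simp
    have er_e: "L2_inner M er (e p) = 0" "L2_inner M (e p) er = 0" if "p < r" for p
      unfolding er_def[abs_def] L2_inner_scale_left L2_inner_scale_right
      using v(4)[OF that] v'[OF that] by simp_all
    \<comment> \<open>This undoes the elimination: the component along \<open>er\<close> contributes
      \<open>c p * cnj (c q) * E r r\<close>, which by \<open>Ec\<close> equals the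
      \<open>c p * E r q\<close> removed in \<open>E'\<close>.\<close>
    define e' where "e' p = (if p = r then er else (\<lambda>t. e p t + c p * er t))" for p
    have "e' p \<in> L2 M" if "p < Suc r" for p
      using that er e(1)[of p] by (auto simp: e'_def intro!: L2_add L2_scale)
    moreover have "L2_inner M (e' p) w = 0" if "p < Suc r" "w \<in> W" for p w
    proof -
      have "w \<in> L2 M" using W that by auto
      then show ?thesis
        using that er e(1,2)[of p] er_w by (auto simp: e'_def L2_inner_linear L2_scale less_Suc_eq)
    qed
    moreover have "L2_inner M (e' p) (e' q) = E p q" if "p < Suc r" "q < Suc r" for p q
      using that er e(1) er_e er_er cE Ec[of q] e(3)
      by (auto simp: e'_def L2_inner_linear L2_scale L2_add less_Suc_eq E'_def algebra_simps)
    ultimately show ?thesis by (intro exI[of _ e']) blast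
  qed
qed

text \<open>Weak limits lose norm and correlation; a perturbation orthogonal to them, of either sign,
restores the limiting Gram matrix.\<close>

lemma L2_restore_gram:
  fixes r :: nat
  assumes x: "\<And>n p. p < r \<Longrightarrow> x n p \<in> L2 M"
    and weak: "\<And>p. p < r \<Longrightarrow> L2_weakly M (\<lambda>n. x n p) (y p)"
    and gram: "\<And>p q. p < r \<Longrightarrow> q < r \<Longrightarrow> (\<lambda>n. L2_inner M (x n p) (x n q)) \<longlonglongrightarrow> G p q"
  shows "\<exists>e. (\<forall>p<r. e p \<in> L2 M) \<and> (\<forall>s\<in>{1, -1}. \<forall>p<r. \<forall>q<r.
    L2_inner M (\<lambda>t. y p t + s * e p t) (\<lambda>t. y q t + s * e q t) = G p q)"
proof -
  have y: "y p \<in> L2 M" if "p < r" for p using weak[OF that] by (simp add: L2_weakly_def)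
  have "\<exists>e. (\<forall>p<r. e p \<in> L2 M \<and> (\<forall>w\<in>y ` {..<r}. L2_inner M (e p) w = 0))
    \<and> (\<forall>p<r. \<forall>q<r. L2_inner M (e p) (e q) = G p q - L2_inner M (y p) (y q))"
  \<comment> \<open>The differences from the weak limits are weakly null and their Gram matrices
    tend to the deficit. Its positive semidefiniteness thus never has to be stated: it is built into
    being a limit of Gram matrices.\<close>
  proof (rule L2_realise_limit_gram[where psi = "\<lambda>n p t. x n p t - y p t"])
    show "(\<lambda>t. x n p t - y p t) \<in> L2 M" if "p < r" for n p
      by (intro L2_diff x y that)
    show "L2_weakly M (\<lambda>n t. x n p t - y p t) (\<lambda>x. 0)" if "p < r" for p
    proof -
      have "(\<lambda>n. L2_inner M (\<lambda>t. x n p t - y p t) v) \<longlonglongrightarrow> 0" if v: "v \<in> L2 M" for v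
        using L2_weakly_left[OF weak[OF \<open>p < r\<close>] v] x y v \<open>p < r\<close>
        by (simp add: L2_inner_diff_left LIM_zero_iff)
      then show ?thesis by (simp add: L2_weakly_def)
    qed
    show "(\<lambda>n. L2_inner M (\<lambda>t. x n p t - y p t) (\<lambda>t. x n q t - y q t)) \<longlonglongrightarrow> G p q - L2_inner M (y p) (y q)"
      if "p < r" "q < r" for p q
    proof -
      have "(\<lambda>n. L2_inner M (x n p) (x n q) - L2_inner M (y p) (x n q)
          - (L2_inner M (x n p) (y q) - L2_inner M (y p) (y q)))
        \<longlonglongrightarrow> G p q - L2_inner M (y p) (y q) - (L2_inner M (y p) (y q) - L2_inner M (y p) (y q))"
        using that by (intro tendsto_diff tendsto_const gram L2_weakly_left[OF weak] L2_weakly_right[OF weak] y)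
      then show ?thesis
        using x y that by (simp add: L2_inner_diff_left L2_inner_diff_right L2_diff algebra_simps)
    qed
  qed (use y in auto)
  then obtain e where e': "\<forall>p<r. e p \<in> L2 M \<and> (\<forall>w\<in>y ` {..<r}. L2_inner M (e p) w = 0)"
    and e'': "\<forall>p<r. \<forall>q<r. L2_inner M (e p) (e q) = G p q - L2_inner M (y p) (y q)"
    by (elim exE conjE)
  then have e: "\<And>p. p < r \<Longrightarrow> e p \<in> L2 M"
    and orth: "\<And>p q. p < r \<Longrightarrow> q < r \<Longrightarrow> L2_inner M (e p) (y q) = 0"
    and ee: "\<And>p q. p < r \<Longrightarrow> q < r \<Longrightarrow> L2_inner M (e p) (e q) = G p q - L2_inner M (y p) (y q)"
    by simp_all
  have orth': "L2_inner M (y q) (e p) = 0" if "p < r" "q < r" for p q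
    using orth[OF that] L2_inner_cnj[of M "e p" "y q"] by simp
  have "L2_inner M (\<lambda>t. y p t + s * e p t) (\<lambda>t. y q t + s * e q t) = G p q"
    if "s \<in> {1, -1}" "p < r" "q < r" for s :: complex and p q
  proof -
    have "L2_inner M (\<lambda>t. y p t + s * e p t) (\<lambda>t. y q t + s * e q t)
        = L2_inner M (y p) (y q) + s * cnj s * L2_inner M (e p) (e q)"
      using that e y orth orth' by (simp add: L2_inner_linear L2_add L2_scale)
    also have "s * cnj s = 1" using that by auto
    finally show ?thesis using ee that by simp
  qed
  with e show ?thesis by blast
qed

subsection \<open>Weak convergence of product functions\<close>

context product_sigma_finite
begin

lemma L2_prod:
  assumes "finite I" "\<And>i. i \<in> I \<Longrightarrow> v i \<in> L2 (M i)"
  shows "(\<lambda>z. \<Prod>i\<in>I. v i (z i)) \<in> L2 (PiM I M)"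
proof -
  have [measurable]: "v i \<in> borel_measurable (M i)" if "i \<in> I" for i
    using assms(2)[OF that] by (simp add: L2_def)
  have "(\<lambda>z. \<Prod>i\<in>I. v i (z i)) \<in> borel_measurable (PiM I M)"
    by measurable
  moreover have "integrable (PiM I M) (\<lambda>z. \<Prod>i\<in>I. (cmod (v i (z i)))\<^sup>2)"
    using assms by (intro product_integrable_prod) (auto simp: L2_def)
  ultimately show ?thesis
    by (simp add: L2_def prod_norm[symmetric] prod_power_distrib)
qed

lemma L2_inner_prod:
  assumes "finite I" "\<And>i. i \<in> I \<Longrightarrow> v i \<in> L2 (M i)" "\<And>i. i \<in> I \<Longrightarrow> w i \<in> L2 (M i)"
  shows "L2_inner (PiM I M) (\<lambda>z. \<Prod>i\<in>I. v i (z i)) (\<lambda>z. \<Prod>i\<in>I. w i (z i))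
    = (\<Prod>i\<in>I. L2_inner (M i) (v i) (w i))"
  unfolding L2_inner_def cnj_prod prod.distrib[symmetric]
  using assms by (intro product_integral_prod integrable_mult_cnj) auto

context
  fixes I :: "'i set" and i :: 'i and f :: "('i \<Rightarrow> 'a) \<Rightarrow> complex"
  assumes I: "finite I" "i \<notin> I" and f: "f \<in> L2 (PiM (insert i I) M)"
begin

lemma slice_pair_measurable [measurable]:
  "(\<lambda>(z, t). f (z(i := t))) \<in> borel_measurable (PiM I M \<Otimes>\<^sub>M M i)"
proof -
  have "f \<in> borel_measurable (PiM (insert i I) M)" using f by (simp add: L2_def)
  from measurable_compose[OF measurable_add_dim this] show ?thesis
    by (simp add: case_prod_unfold)
qed

lemma slice_nn_integral:
  "(\<integral>\<^sup>+z. (\<integral>\<^sup>+t. ennreal ((cmod (f (z(i := t))))\<^sup>2) \<partial>M i) \<partial>PiM I M) < \<infinity>"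
proof -
  have [measurable]: "f \<in> borel_measurable (PiM (insert i I) M)" using f by (simp add: L2_def)
  have "(\<integral>\<^sup>+z. (\<integral>\<^sup>+t. ennreal ((cmod (f (z(i := t))))\<^sup>2) \<partial>M i) \<partial>PiM I M)
      = (\<integral>\<^sup>+z. ennreal ((cmod (f z))\<^sup>2) \<partial>PiM (insert i I) M)"
    by (rule product_nn_integral_insert[symmetric]) (use I in measurable)
  also have "\<dots> < \<infinity>" unfolding nn_integral_cmod_squared[OF f] by simp
  finally show ?thesis .
qed

lemma AE_slice_L2: "AE z in PiM I M. (\<lambda>t. f (z(i := t))) \<in> L2 (M i)"
proof -
  interpret sigma_finite_measure "M i" by (rule sigma_finite_measures)
  have "AE z in PiM I M. (\<integral>\<^sup>+t. ennreal ((cmod (f (z(i := t))))\<^sup>2) \<partial>M i) \<noteq> \<infinity>"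
    using slice_nn_integral by (intro nn_integral_PInf_AE) auto
  \<comment> \<open>Measurability of the slice in \<open>t\<close> is obtained only for
    \<open>z\<close> in the space.\<close>
  moreover have "AE z in PiM I M. z \<in> space (PiM I M)" by (rule AE_space)
  ultimately show ?thesis
  proof eventually_elim
    case (elim z)
    have "(\<lambda>t. (\<lambda>(z, t). f (z(i := t))) (z, t)) \<in> borel_measurable (M i)"
      using slice_pair_measurable elim(2) by (rule measurable_compose_Pair1[rotated])
    then show ?case
      using elim(1) by (simp add: L2_def integrable_iff_bounded less_top)
  qed
qed

text \<open>Through Cauchy-Schwarz in the variable \<open>t\<close>, this provides the integrable
  majorant for all contractions of \<open>f\<close> with a function of that variable.\<close>

lemma integrable_slice_norm:
  "integrable (PiM I M) (\<lambda>z. (L2_norm (M i) (\<lambda>t. f (z(i := t))))\<^sup>2)"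
proof -
  interpret sigma_finite_measure "M i" by (rule sigma_finite_measures)
  have "(\<lambda>z. (L2_norm (M i) (\<lambda>t. f (z(i := t))))\<^sup>2) \<in> borel_measurable (PiM I M)"
    unfolding L2_norm_squared by measurable
  moreover have "(\<integral>\<^sup>+z. ennreal (norm ((L2_norm (M i) (\<lambda>t. f (z(i := t))))\<^sup>2)) \<partial>PiM I M)
      = (\<integral>\<^sup>+z. (\<integral>\<^sup>+t. ennreal ((cmod (f (z(i := t))))\<^sup>2) \<partial>M i) \<partial>PiM I M)"
    by (rule nn_integral_cong_AE, use AE_slice_L2 in eventually_elim)
      (simp add: nn_integral_cmod_squared)
  ultimately show ?thesis
    using slice_nn_integral by (simp add: integrable_iff_bounded)
qed

lemma slice_inner_measurable:
  assumes "v \<in> L2 (M i)"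
  shows "(\<lambda>z. L2_inner (M i) (\<lambda>t. f (z(i := t))) v) \<in> borel_measurable (PiM I M)"
proof -
  interpret sigma_finite_measure "M i" by (rule sigma_finite_measures)
  have [measurable]: "v \<in> borel_measurable (M i)" using assms by (simp add: L2_def)
  show ?thesis unfolding L2_inner_def by measurable
qed

lemma slice_inner_L2:
  assumes v: "v \<in> L2 (M i)"
  shows "(\<lambda>z. L2_inner (M i) (\<lambda>t. f (z(i := t))) v) \<in> L2 (PiM I M)"
proof -
  note [measurable] = slice_inner_measurable[OF v]
  have "integrable (PiM I M) (\<lambda>z. (cmod (L2_inner (M i) (\<lambda>t. f (z(i := t))) v))\<^sup>2)"
  proof (rule Bochner_Integration.integrable_bound)
    show "integrable (PiM I M) (\<lambda>z. (L2_norm (M i) (\<lambda>t. f (z(i := t))))\<^sup>2 * (L2_norm (M i) v)\<^sup>2)"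
      by (intro integrable_mult_left integrable_slice_norm)
    show "AE z in PiM I M. norm ((cmod (L2_inner (M i) (\<lambda>t. f (z(i := t))) v))\<^sup>2)
        \<le> norm ((L2_norm (M i) (\<lambda>t. f (z(i := t))))\<^sup>2 * (L2_norm (M i) v)\<^sup>2)"
      using AE_slice_L2
    proof eventually_elim
      case (elim z)
      show ?case
        using power_mono[OF L2_Cauchy_Schwarz[OF elim v], of 2] by (simp add: power_mult_distrib)
    qed
  qed measurable
  then show ?thesis using slice_inner_measurable[OF v] by (simp add: L2_def)
qed

text \<open>Fubini: integrating out the variable \<open>i\<close> replaces \<open>f\<close> by its
  contraction with \<open>v i\<close> and removes one factor, which is the step for an induction
  over the modes.\<close>

lemma L2_inner_slice:
  assumes v: "\<And>j. j \<in> insert i I \<Longrightarrow> v j \<in> L2 (M j)"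
  shows "L2_inner (PiM (insert i I) M) f (\<lambda>z. \<Prod>j\<in>insert i I. v j (z j))
    = L2_inner (PiM I M) (\<lambda>z. L2_inner (M i) (\<lambda>t. f (z(i := t))) (v i)) (\<lambda>z. \<Prod>j\<in>I. v j (z j))"
proof -
  have "integrable (PiM (insert i I) M) (\<lambda>z. f z * cnj (\<Prod>j\<in>insert i I. v j (z j)))"
    using I v by (intro integrable_mult_cnj f L2_prod) auto
  then have "L2_inner (PiM (insert i I) M) f (\<lambda>z. \<Prod>j\<in>insert i I. v j (z j))
    = (\<integral>z. (\<integral>t. f (z(i := t)) * cnj (\<Prod>j\<in>insert i I. v j ((z(i := t)) j)) \<partial>M i) \<partial>PiM I M)"
    unfolding L2_inner_def by (rule product_integral_insert[OF I])
  also have "\<dots> = (\<integral>z. (\<integral>t. (f (z(i := t)) * cnj (v i t)) * cnj (\<Prod>j\<in>I. v j (z j)) \<partial>M i) \<partial>PiM I M)"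
  proof (intro Bochner_Integration.integral_cong refl)
    fix z t
    have "(\<Prod>j\<in>I. v j ((z(i := t)) j)) = (\<Prod>j\<in>I. v j (z j))"
      using I by (intro prod.cong) auto
    then show "f (z(i := t)) * cnj (\<Prod>j\<in>insert i I. v j ((z(i := t)) j))
      = (f (z(i := t)) * cnj (v i t)) * cnj (\<Prod>j\<in>I. v j (z j))"
      unfolding prod.insert[OF I] by (simp only: complex_cnj_mult fun_upd_same mult.assoc)
  qed
  also have "\<dots> = L2_inner (PiM I M) (\<lambda>z. L2_inner (M i) (\<lambda>t. f (z(i := t))) (v i)) (\<lambda>z. \<Prod>j\<in>I. v j (z j))"
    unfolding L2_inner_def integral_mult_left_zero ..
  finally show ?thesis .
qed

text \<open>Contraction turns weak convergence of a factor into norm convergence: almost every slice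
  of \<open>f\<close> is a legitimate test function, giving convergence pointwise in
  \<open>z\<close>, and a multiple of the squared slice norm dominates.\<close>

lemma slice_inner_tendsto:
  assumes x: "\<And>n. x n \<in> L2 (M i)" "\<And>n. L2_norm (M i) (x n) \<le> 1" and weak: "L2_weakly (M i) x y"
  shows "(\<lambda>n. L2_norm (PiM I M) (\<lambda>z. L2_inner (M i) (\<lambda>t. f (z(i := t))) (x n)
    - L2_inner (M i) (\<lambda>t. f (z(i := t))) y)) \<longlonglongrightarrow> 0"
proof -
  have y: "y \<in> L2 (M i)" using weak by (simp add: L2_weakly_def)
  note [measurable] = slice_inner_measurable[OF y] slice_inner_measurable[OF x(1)]
  define D where "D n z = L2_inner (M i) (\<lambda>t. f (z(i := t))) (x n) - L2_inner (M i) (\<lambda>t. f (z(i := t))) y" for n z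
  define C where "C = 1 + L2_norm (M i) y"
  have [measurable]: "D n \<in> borel_measurable (PiM I M)" for n unfolding D_def by measurable
  have xy: "L2_norm (M i) (\<lambda>t. x n t - y t) \<le> C" for n
    using L2_norm_add_le[OF x(1) L2_scale[OF y, of "-1"], of n] x(2)[of n]
      L2_norm_scale[of "M i" "-1" y] by (simp add: C_def)
  have "(\<lambda>n. \<integral>z. (cmod (D n z))\<^sup>2 \<partial>PiM I M) \<longlonglongrightarrow> (\<integral>z. 0 \<partial>PiM I M)"
  proof (rule integral_dominated_convergence)
    show "integrable (PiM I M) (\<lambda>z. (L2_norm (M i) (\<lambda>t. f (z(i := t))))\<^sup>2 * C\<^sup>2)"
      by (intro integrable_mult_left integrable_slice_norm)
    show "AE z in PiM I M. (\<lambda>n. (cmod (D n z))\<^sup>2) \<longlonglongrightarrow> 0"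
      using AE_slice_L2
    proof eventually_elim
      case (elim z)
      have "(\<lambda>n. (cmod (D n z))\<^sup>2) \<longlonglongrightarrow>
          (cmod (L2_inner (M i) (\<lambda>t. f (z(i := t))) y - L2_inner (M i) (\<lambda>t. f (z(i := t))) y))\<^sup>2"
        unfolding D_def by (intro tendsto_intros L2_weakly_right[OF weak elim])
      then show ?case by simp
    qed
    show "AE z in PiM I M. norm ((cmod (D n z))\<^sup>2) \<le> (L2_norm (M i) (\<lambda>t. f (z(i := t))))\<^sup>2 * C\<^sup>2" for n
      using AE_slice_L2
    proof eventually_elim
      case (elim z)
      have "cmod (D n z) = cmod (L2_inner (M i) (\<lambda>t. f (z(i := t))) (\<lambda>t. x n t - y t))"
        unfolding D_def using x y elim by (simp add: L2_inner_diff_right)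
      also have "\<dots> \<le> L2_norm (M i) (\<lambda>t. f (z(i := t))) * L2_norm (M i) (\<lambda>t. x n t - y t)"
        by (intro L2_Cauchy_Schwarz elim L2_diff x y)
      also have "\<dots> \<le> L2_norm (M i) (\<lambda>t. f (z(i := t))) * C"
        by (intro mult_left_mono xy) simp
      finally have "(cmod (D n z))\<^sup>2 \<le> (L2_norm (M i) (\<lambda>t. f (z(i := t))) * C)\<^sup>2"
        by (intro power_mono) simp_all
      then show ?case by (simp add: power_mult_distrib)
    qed
  qed measurable
  then have "(\<lambda>n. sqrt (\<integral>z. (cmod (D n z))\<^sup>2 \<partial>PiM I M)) \<longlonglongrightarrow> sqrt 0"
    by (intro tendsto_intros) simp
  then show ?thesis by (simp add: L2_norm_def D_def)
qed

end

text \<open>With \<open>f\<close> contracted in mode \<open>i\<close>, the inner product is that of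
  \<open>g n\<close> with the remaining product \<open>T n\<close>. Replacing \<open>g n\<close> by
  its norm limit \<open>h\<close> costs a null sequence, because \<open>T n\<close> has norm at most
  1; the rest is the induction hypothesis for \<open>h\<close>, which is why \<open>f\<close> is
  generalised.\<close>

lemma L2_inner_prod_tendsto:
  assumes "finite I"
    and "\<And>i n. i \<in> I \<Longrightarrow> x n i \<in> L2 (M i)" "\<And>i n. i \<in> I \<Longrightarrow> L2_norm (M i) (x n i) \<le> 1"
    and "\<And>i. i \<in> I \<Longrightarrow> L2_weakly (M i) (\<lambda>n. x n i) (y i)"
    and "f \<in> L2 (PiM I M)"
  shows "(\<lambda>n. L2_inner (PiM I M) f (\<lambda>z. \<Prod>i\<in>I. x n i (z i)))
    \<longlonglongrightarrow> L2_inner (PiM I M) f (\<lambda>z. \<Prod>i\<in>I. y i (z i))"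
  using assms
proof (induction I arbitrary: f rule: finite_induct)
  case empty
  then show ?case by simp
next
  case (insert i I)
  note x = insert.prems(1) and bound = insert.prems(2) and weak = insert.prems(3) and f = insert.prems(4)
  note If = insert.hyps f
  have y: "y j \<in> L2 (M j)" if "j \<in> insert i I" for j
    using weak[OF that] by (simp add: L2_weakly_def)
  define g where "g n z = L2_inner (M i) (\<lambda>t. f (z(i := t))) (x n i)" for n z
  define h where "h z = L2_inner (M i) (\<lambda>t. f (z(i := t))) (y i)" for z
  define T where "T n z = (\<Prod>j\<in>I. x n j (z j))" for n z
  have g: "g n \<in> L2 (PiM I M)" for n
    unfolding g_def by (intro slice_inner_L2[OF If] x) simp
  have h: "h \<in> L2 (PiM I M)"
    unfolding h_def by (intro slice_inner_L2[OF If] y) simp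
  have T: "T n \<in> L2 (PiM I M)" for n
    unfolding T_def using insert.hyps by (intro L2_prod x) auto
  have "complex_of_real ((L2_norm (PiM I M) (T n))\<^sup>2) = (\<Prod>j\<in>I. complex_of_real ((L2_norm (M j) (x n j))\<^sup>2))" for n
    unfolding L2_inner_self[symmetric] T_def using insert.hyps by (intro L2_inner_prod x) auto
  then have "(L2_norm (PiM I M) (T n))\<^sup>2 = (\<Prod>j\<in>I. (L2_norm (M j) (x n j))\<^sup>2)" for n
    by (simp only: of_real_prod[symmetric] of_real_eq_iff)
  moreover have "(\<Prod>j\<in>I. (L2_norm (M j) (x n j))\<^sup>2) \<le> 1" for n
    using bound by (intro prod_le_1) (auto intro: power_le_one)
  ultimately have T1: "L2_norm (PiM I M) (T n) \<le> 1" for n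
    by (metis L2_norm_nonneg abs_of_nonneg abs_square_le_1)
  have "(\<lambda>n. L2_inner (PiM I M) (\<lambda>z. g n z - h z) (T n)) \<longlonglongrightarrow> 0"
  proof (rule Lim_null_comparison)
    show "(\<lambda>n. L2_norm (PiM I M) (\<lambda>z. g n z - h z)) \<longlonglongrightarrow> 0"
      unfolding g_def h_def by (intro slice_inner_tendsto[OF If] x bound weak) simp_all
    have "cmod (L2_inner (PiM I M) (\<lambda>z. g n z - h z) (T n)) \<le> L2_norm (PiM I M) (\<lambda>z. g n z - h z)" for n
    proof -
      have "cmod (L2_inner (PiM I M) (\<lambda>z. g n z - h z) (T n))
          \<le> L2_norm (PiM I M) (\<lambda>z. g n z - h z) * L2_norm (PiM I M) (T n)"
        by (intro L2_Cauchy_Schwarz L2_diff g h T)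
      also have "\<dots> \<le> L2_norm (PiM I M) (\<lambda>z. g n z - h z) * 1"
        by (intro mult_left_mono T1) simp
      finally show ?thesis by simp
    qed
    then show "\<forall>\<^sub>F n in sequentially. norm (L2_inner (PiM I M) (\<lambda>z. g n z - h z) (T n))
        \<le> L2_norm (PiM I M) (\<lambda>z. g n z - h z)" by simp
  qed
  moreover have "(\<lambda>n. L2_inner (PiM I M) h (T n)) \<longlonglongrightarrow> L2_inner (PiM I M) h (\<lambda>z. \<Prod>j\<in>I. y j (z j))"
    unfolding T_def by (rule insert.IH) (use x bound weak h in auto)
  ultimately have "(\<lambda>n. L2_inner (PiM I M) (\<lambda>z. g n z - h z) (T n) + L2_inner (PiM I M) h (T n))
      \<longlonglongrightarrow> 0 + L2_inner (PiM I M) h (\<lambda>z. \<Prod>j\<in>I. y j (z j))"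
    by (rule tendsto_add)
  moreover have "L2_inner (PiM I M) (\<lambda>z. g n z - h z) (T n) + L2_inner (PiM I M) h (T n)
      = L2_inner (PiM (insert i I) M) f (\<lambda>z. \<Prod>j\<in>insert i I. x n j (z j))" for n
  proof -
    have "L2_inner (PiM I M) (\<lambda>z. g n z - h z) (T n) + L2_inner (PiM I M) h (T n) = L2_inner (PiM I M) (g n) (T n)"
      using g h T by (simp add: L2_inner_diff_left)
    also have "\<dots> = L2_inner (PiM (insert i I) M) f (\<lambda>z. \<Prod>j\<in>insert i I. x n j (z j))"
      unfolding g_def T_def by (rule L2_inner_slice[OF If, symmetric]) (rule x)
    finally show ?thesis .
  qed
  moreover have "L2_inner (PiM I M) h (\<lambda>z. \<Prod>j\<in>I. y j (z j))
      = L2_inner (PiM (insert i I) M) f (\<lambda>z. \<Prod>j\<in>insert i I. y j (z j))"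
    unfolding h_def by (rule L2_inner_slice[OF If, symmetric]) (rule y)
  ultimately show ?case by (simp only: add_0_left)
qed

end

subsection \<open>The approximation error\<close>

text \<open>Diagonal dominance: each off-diagonal term is at least \<open>- m\<close> times the mean
  of the two squared moduli, and each index meets \<open>r - 1\<close> others.\<close>

lemma coherent_form_coercive:
  fixes lam :: "nat \<Rightarrow> complex" and H :: "nat \<Rightarrow> nat \<Rightarrow> complex"
  assumes diag: "\<And>p. p < r \<Longrightarrow> H p p = 1"
    and off: "\<And>p q. p < r \<Longrightarrow> q < r \<Longrightarrow> p \<noteq> q \<Longrightarrow> cmod (H p q) \<le> m"
    and "0 \<le> m"
  shows "(1 - (real r - 1) * m) * (\<Sum>p<r. (cmod (lam p))\<^sup>2)
    \<le> Re (\<Sum>p<r. \<Sum>q<r. lam p * cnj (lam q) * H p q)"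
proof -
  define a where "a p = (cmod (lam p))\<^sup>2" for p
  \<comment> \<open>The same \<open>m / 2 * (a p + a q)\<close> is subtracted for every pair, so the
    diagonal carries \<open>1 + m\<close> in compensation. Summation then gives the factor
    \<open>(1 + m) - r * m\<close>.\<close>
  have pair: "(if p = q then (1 + m) * a p else 0) - m / 2 * (a p + a q) \<le> Re (lam p * cnj (lam q) * H p q)"
    if "p < r" "q < r" for p q
  proof (cases "p = q")
    case True
    have "Re (lam p * cnj (lam p)) = a p"
      by (simp add: a_def complex_norm_square[symmetric])
    then show ?thesis using True diag that by (simp add: algebra_simps)
  next
    case False
    have "cmod (lam p * cnj (lam q) * H p q) \<le> (cmod (lam p) * cmod (lam q)) * m"
      unfolding norm_mult complex_mod_cnj using off[OF that False] by (intro mult_left_mono) auto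
    also have "\<dots> \<le> ((a p + a q) / 2) * m"
      unfolding a_def using sum_squares_bound[of "cmod (lam p)" "cmod (lam q)"] \<open>0 \<le> m\<close>
      by (intro mult_right_mono) (auto simp: field_simps)
    finally have "cmod (lam p * cnj (lam q) * H p q) \<le> m / 2 * (a p + a q)"
      by (simp add: mult.commute)
    moreover have "- cmod (lam p * cnj (lam q) * H p q) \<le> Re (lam p * cnj (lam q) * H p q)"
      using abs_Re_le_cmod[of "lam p * cnj (lam q) * H p q"] by linarith
    ultimately show ?thesis using False by simp
  qed
  have "(\<Sum>p<r. \<Sum>q<r. (if p = q then (1 + m) * a p else 0) - m / 2 * (a p + a q))
      = (\<Sum>p<r. \<Sum>q<r. if p = q then (1 + m) * a p else 0) - m / 2 * (\<Sum>p<r. \<Sum>q<r. a p + a q)"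
    by (simp only: sum_subtractf sum_distrib_left)
  also have "\<dots> = (1 + m) * (\<Sum>p<r. a p) - m / 2 * (real r * (\<Sum>p<r. a p) + real r * (\<Sum>p<r. a p))"
    by (simp add: sum.distrib sum_distrib_left[symmetric] sum.delta)
  also have "\<dots> = (1 - (real r - 1) * m) * (\<Sum>p<r. a p)"
    by (simp add: algebra_simps)
  finally have eq: "(1 - (real r - 1) * m) * (\<Sum>p<r. a p)
      = (\<Sum>p<r. \<Sum>q<r. (if p = q then (1 + m) * a p else 0) - m / 2 * (a p + a q))" by (rule sym)
  show ?thesis
    unfolding a_def[symmetric] Re_sum eq by (intro sum_mono pair) auto
qed

context
  fixes M :: "nat \<Rightarrow> 'a measure" and d r :: nat and f :: "(nat \<Rightarrow> 'a) \<Rightarrow> complex"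
  assumes M: "product_sigma_finite M" and f: "f \<in> L2 (PiM {..<d} M)"
begin

interpretation product_sigma_finite M by (rule M)

lemma tensor_L2: "(\<And>k. k < d \<Longrightarrow> v k \<in> L2 (M k)) \<Longrightarrow> tensor d v \<in> L2 (PiM {..<d} M)"
  unfolding tensor_def by (rule L2_prod) auto

lemma tensor_update_add:
  assumes "j < d"
  shows "tensor d (v(j := \<lambda>t. a t + c * b t)) z = tensor d (v(j := a)) z + c * tensor d (v(j := b)) z"
proof -
  have *: "tensor d (v(j := u)) z = u (z j) * (\<Prod>k\<in>{..<d} - {j}. v k (z k))" for u
  proof -
    have "tensor d (v(j := u)) z = (v(j := u)) j (z j) * (\<Prod>k\<in>{..<d} - {j}. (v(j := u)) k (z k))"
      unfolding tensor_def using assms by (intro prod.remove) auto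
    also have "(\<Prod>k\<in>{..<d} - {j}. (v(j := u)) k (z k)) = (\<Prod>k\<in>{..<d} - {j}. v k (z k))"
      by (intro prod.cong) auto
    finally show ?thesis by (simp only: fun_upd_same)
  qed
  show ?thesis unfolding * by (simp add: algebra_simps)
qed

lemma L2_inner_tensor_update:
  assumes "j < d" and v: "\<And>k. k < d \<Longrightarrow> v k \<in> L2 (M k)" and "a \<in> L2 (M j)" "b \<in> L2 (M j)"
  shows "L2_inner (PiM {..<d} M) f (tensor d (v(j := \<lambda>t. a t + c * b t)))
    = L2_inner (PiM {..<d} M) f (tensor d (v(j := a)))
      + cnj c * L2_inner (PiM {..<d} M) f (tensor d (v(j := b)))"
proof -
  have "tensor d (v(j := a)) \<in> L2 (PiM {..<d} M)" "tensor d (v(j := b)) \<in> L2 (PiM {..<d} M)"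
    using assms by (auto intro!: tensor_L2)
  then show ?thesis
    using f unfolding tensor_update_add[OF assms(1), abs_def]
    by (simp add: L2_inner_add_right L2_inner_scale_right L2_scale)
qed

lemma combination_L2:
  assumes "\<And>k p. k < d \<Longrightarrow> p < r \<Longrightarrow> phi k p \<in> L2 (M k)"
  shows "(\<lambda>x. \<Sum>p<r. lam p * tensor d (\<lambda>k. phi k p) x) \<in> L2 (PiM {..<d} M)"
  using assms by (intro L2_sum L2_scale tensor_L2) auto

lemma combination_norm_squared:
  assumes phi: "\<And>k p. k < d \<Longrightarrow> p < r \<Longrightarrow> phi k p \<in> L2 (M k)"
  shows "(L2_norm (PiM {..<d} M) (\<lambda>x. \<Sum>p<r. lam p * tensor d (\<lambda>k. phi k p) x))\<^sup>2
    = Re (\<Sum>p<r. \<Sum>q<r. lam p * cnj (lam q) * (\<Prod>k<d. L2_inner (M k) (phi k p) (phi k q)))"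
proof -
  define T where "T p = tensor d (\<lambda>k. phi k p)" for p
  have T: "T p \<in> L2 (PiM {..<d} M)" if "p < r" for p
    unfolding T_def using phi that by (intro tensor_L2) auto
  have TT: "L2_inner (PiM {..<d} M) (T p) (T q) = (\<Prod>k<d. L2_inner (M k) (phi k p) (phi k q))"
    if "p < r" "q < r" for p q
    unfolding T_def tensor_def using phi that by (intro L2_inner_prod) auto
  have inner: "L2_inner (PiM {..<d} M) (T p) (\<lambda>x. \<Sum>q<r. lam q * T q x)
      = (\<Sum>q<r. cnj (lam q) * (\<Prod>k<d. L2_inner (M k) (phi k p) (phi k q)))" if "p < r" for p
    using that T TT by (subst L2_inner_sum_right) (auto simp: L2_inner_scale_right intro!: L2_scale)
  have "L2_inner (PiM {..<d} M) (\<lambda>x. \<Sum>p<r. lam p * T p x) (\<lambda>x. \<Sum>q<r. lam q * T q x)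
      = (\<Sum>p<r. lam p * L2_inner (PiM {..<d} M) (T p) (\<lambda>x. \<Sum>q<r. lam q * T q x))"
    using T by (subst L2_inner_sum_left) (auto simp: L2_inner_scale_left intro!: L2_scale L2_sum)
  also have "\<dots> = (\<Sum>p<r. \<Sum>q<r. lam p * cnj (lam q) * (\<Prod>k<d. L2_inner (M k) (phi k p) (phi k q)))"
    by (intro sum.cong refl) (simp add: inner sum_distrib_left mult.assoc)
  finally show ?thesis
    unfolding L2_inner_self T_def by (metis Re_complex_of_real)
qed

lemma approx_err_squared:
  assumes phi: "\<And>k p. k < d \<Longrightarrow> p < r \<Longrightarrow> phi k p \<in> L2 (M k)"
  shows "(approx_err d M f r lam phi)\<^sup>2 = (L2_norm (PiM {..<d} M) f)\<^sup>2
    - 2 * Re (\<Sum>p<r. cnj (lam p) * L2_inner (PiM {..<d} M) f (tensor d (\<lambda>k. phi k p)))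
    + Re (\<Sum>p<r. \<Sum>q<r. lam p * cnj (lam q) * (\<Prod>k<d. L2_inner (M k) (phi k p) (phi k q)))"
proof -
  have "L2_inner (PiM {..<d} M) f (\<lambda>x. \<Sum>p<r. lam p * tensor d (\<lambda>k. phi k p) x)
      = (\<Sum>p<r. cnj (lam p) * L2_inner (PiM {..<d} M) f (tensor d (\<lambda>k. phi k p)))"
    using phi f
    by (subst L2_inner_sum_right) (auto simp: L2_inner_scale_right intro!: L2_scale tensor_L2)
  then show ?thesis
    unfolding approx_err_def using f phi
    by (simp add: L2_norm_diff_squared combination_L2 combination_norm_squared)
qed

text \<open>The triangle inequality bounds the norm of the approximant by \<open>K\<close>, and
  coercivity of the entrywise product of the Gram matrices carries the bound over to the
  coefficients.\<close>

lemma coefficients_bounded: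
  assumes adm: "admissible d M r mu phi" and mu: "\<And>k. k < d \<Longrightarrow> 0 \<le> mu k"
    and c: "c = 1 - (real r - 1) * (\<Prod>k<d. mu k)" "0 < c"
    and K: "approx_err d M f r lam phi + L2_norm (PiM {..<d} M) f \<le> K" and "p < r"
  shows "cmod (lam p) \<le> sqrt (K\<^sup>2 / c)"
proof -
  have phi: "phi k p \<in> L2 (M k)" "L2_norm (M k) (phi k p) = 1" if "k < d" "p < r" for k p
    using adm that by (auto simp: admissible_def)
  define S where "S = (\<lambda>x. \<Sum>p<r. lam p * tensor d (\<lambda>k. phi k p) x)"
  have S: "S \<in> L2 (PiM {..<d} M)" unfolding S_def by (rule combination_L2) (rule phi)
  have "L2_norm (PiM {..<d} M) (\<lambda>x. f x + (-1) * (f x - S x))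
      \<le> L2_norm (PiM {..<d} M) f + L2_norm (PiM {..<d} M) (\<lambda>x. (-1) * (f x - S x))"
    by (intro L2_norm_add_le L2_scale L2_diff f S)
  also have "\<dots> \<le> K"
    unfolding L2_norm_scale using K by (simp add: approx_err_def S_def)
  finally have S_le: "(L2_norm (PiM {..<d} M) S)\<^sup>2 \<le> K\<^sup>2"
    by (intro power_mono) simp_all
  have S_norm: "(L2_norm (PiM {..<d} M) S)\<^sup>2
      = Re (\<Sum>p<r. \<Sum>q<r. lam p * cnj (lam q) * (\<Prod>k<d. L2_inner (M k) (phi k p) (phi k q)))"
    unfolding S_def by (rule combination_norm_squared) (rule phi)
  have "c * (\<Sum>p<r. (cmod (lam p))\<^sup>2) \<le> (L2_norm (PiM {..<d} M) S)\<^sup>2"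
    unfolding S_norm c(1)
  proof (rule coherent_form_coercive)
    show "(\<Prod>k<d. L2_inner (M k) (phi k p) (phi k p)) = 1" if "p < r" for p
      using phi that by (intro prod.neutral) (auto simp: L2_inner_self)
    show "cmod (\<Prod>k<d. L2_inner (M k) (phi k p) (phi k q)) \<le> (\<Prod>k<d. mu k)"
      if "p < r" "q < r" "p \<noteq> q" for p q
      unfolding prod_norm[symmetric]
      using adm that by (intro prod_mono) (auto simp: admissible_def coherence_le_def)
    show "0 \<le> (\<Prod>k<d. mu k)" using mu by (intro prod_nonneg) auto
  qed
  moreover have "(cmod (lam p))\<^sup>2 \<le> (\<Sum>p<r. (cmod (lam p))\<^sup>2)"
    using \<open>p < r\<close> by (intro member_le_sum) auto
  ultimately have "c * (cmod (lam p))\<^sup>2 \<le> K\<^sup>2"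
    using S_le \<open>0 < c\<close> by (meson less_imp_le mult_left_mono order_trans)
  then have "(cmod (lam p))\<^sup>2 \<le> K\<^sup>2 / c"
    using \<open>0 < c\<close> by (simp add: field_simps)
  then show ?thesis by (rule real_le_rsqrt)
qed

text \<open>The correlation with \<open>f\<close> is affine in each factor, so one of the two signs does not
decrease it.\<close>

lemma exists_signs_correlation_le:
  assumes y: "\<And>k p. k < d \<Longrightarrow> p < r \<Longrightarrow> y k p \<in> L2 (M k)"
    and e: "\<And>k p. k < d \<Longrightarrow> p < r \<Longrightarrow> e k p \<in> L2 (M k)"
  shows "\<exists>s. (\<forall>k. s k \<in> {1, -1}) \<and>
    Re (\<Sum>p<r. cnj (l p) * L2_inner (PiM {..<d} M) f (tensor d (\<lambda>k. y k p)))
    \<le> Re (\<Sum>p<r. cnj (l p) * L2_inner (PiM {..<d} M) f (tensor d (\<lambda>k t. y k p t + s k * e k p t)))"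
proof -
  define F where "F v = Re (\<Sum>p<r. cnj (l p) * L2_inner (PiM {..<d} M) f (tensor d (\<lambda>k. v k p)))"
    for v :: "nat \<Rightarrow> nat \<Rightarrow> 'a \<Rightarrow> complex"
  \<comment> \<open>Hybrid between the two systems: the modes below \<open>j\<close> are already
    perturbed, the others still carry the weak limits.\<close>
  define w where "w s j k p = (if k < j then (\<lambda>t. y k p t + s k * e k p t) else y k p)"
    for s :: "nat \<Rightarrow> complex" and j k p
  have w: "w s j k p \<in> L2 (M k)" if "k < d" "p < r" for s j k p
    using y[OF that] e[OF that] by (auto simp: w_def)
  have "\<exists>s. (\<forall>k. s k \<in> {1, -1}) \<and> F y \<le> F (w s j)" if "j \<le> d" for j
    using that
  proof (induction j)
    case 0
    have "w s 0 = y" for s by (simp add: w_def fun_eq_iff)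
    then show ?case by (intro exI[of _ "\<lambda>_. 1"]) simp
  next
    case (Suc j)
    then obtain s where s: "\<forall>k. s k \<in> {1, -1}" "F y \<le> F (w s j)" by auto
    \<comment> \<open>Perturbing mode \<open>j\<close> changes the correlation by \<open>X\<close>
      or \<open>- X\<close>, where \<open>X\<close> has \<open>e j\<close> in place of the whole
      mode \<open>j\<close>, for all \<open>p\<close> at once. The sign is then taken to match that
      of \<open>X\<close>.\<close>
    define X where "X = F ((w s j)(j := e j))"
    have step: "F (w (s(j := \<sigma>)) (Suc j)) = F (w s j) + Re \<sigma> * X" if "\<sigma> \<in> {1, -1}" for \<sigma>
    proof -
      have upd: "(\<lambda>k. w (s(j := \<sigma>)) (Suc j) k p) = (\<lambda>k. w s j k p)(j := \<lambda>t. y j p t + \<sigma> * e j p t)"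
        "(\<lambda>k. w s j k p) = (\<lambda>k. w s j k p)(j := y j p)"
        "(\<lambda>k. ((w s j)(j := e j)) k p) = (\<lambda>k. w s j k p)(j := e j p)" for p
        by (auto simp: w_def fun_eq_iff)
      have "F (w (s(j := \<sigma>)) (Suc j))
        = Re (\<Sum>p<r. cnj (l p) * (L2_inner (PiM {..<d} M) f (tensor d (\<lambda>k. w s j k p))
            + cnj \<sigma> * L2_inner (PiM {..<d} M) f (tensor d (\<lambda>k. ((w s j)(j := e j)) k p))))"
        unfolding F_def
      proof (intro arg_cong[of _ _ Re] sum.cong refl)
        fix p assume "p \<in> {..<r}"
        then have "p < r" by simp
        have "L2_inner (PiM {..<d} M) f (tensor d (\<lambda>k. w (s(j := \<sigma>)) (Suc j) k p))
          = L2_inner (PiM {..<d} M) f (tensor d ((\<lambda>k. w s j k p)(j := y j p)))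
            + cnj \<sigma> * L2_inner (PiM {..<d} M) f (tensor d ((\<lambda>k. w s j k p)(j := e j p)))"
          unfolding upd(1) using Suc.prems \<open>p < r\<close> y e w by (intro L2_inner_tensor_update) auto
        then show "cnj (l p) * L2_inner (PiM {..<d} M) f (tensor d (\<lambda>k. w (s(j := \<sigma>)) (Suc j) k p))
          = cnj (l p) * (L2_inner (PiM {..<d} M) f (tensor d (\<lambda>k. w s j k p))
            + cnj \<sigma> * L2_inner (PiM {..<d} M) f (tensor d (\<lambda>k. ((w s j)(j := e j)) k p)))"
          unfolding upd(2)[symmetric] upd(3)[symmetric] by simp
      qed
      also have "\<dots> = F (w s j) + Re \<sigma> * X"
        using that unfolding F_def X_def
        by (auto simp: distrib_left sum.distrib sum_negf right_diff_distrib sum_subtractf)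
      finally show ?thesis .
    qed
    define \<sigma> :: complex where "\<sigma> = (if 0 \<le> X then 1 else -1)"
    have "F y \<le> F (w (s(j := \<sigma>)) (Suc j))"
      using s(2) step[of \<sigma>] by (auto simp: \<sigma>_def)
    moreover have "\<forall>k. (s(j := \<sigma>)) k \<in> {1, -1}" using s(1) by (auto simp: \<sigma>_def)
    ultimately show ?case by blast
  qed
  then obtain s where s: "\<forall>k. s k \<in> {1, -1}" "F y \<le> F (w s d)" by blast
  have "tensor d (\<lambda>k. w s d k p) = tensor d (\<lambda>k t. y k p t + s k * e k p t)" for p
    by (simp add: tensor_def w_def)
  with s show ?thesis unfolding F_def by auto
qed

end

subsection \<open>Attainment\<close>

lemma infimum_attained:
  fixes M :: "nat \<Rightarrow> 'a measure" and d r :: nat and f :: "(nat \<Rightarrow> 'a) \<Rightarrow> complex"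
    and mu :: "nat \<Rightarrow> real"
  assumes M: "product_sigma_finite M" and f: "f \<in> L2 (PiM {..<d} M)"
    and mu: "\<And>k. k < d \<Longrightarrow> 0 \<le> mu k"
    and coherence: "(real r - 1) * (\<Prod>k<d. mu k) < 1"
    and nonempty: "\<exists>phi. admissible d M r mu phi"
  shows "\<exists>lam phi. admissible d M r mu phi \<and>
           approx_err d M f r lam phi
             = Inf {approx_err d M f r lam' phi' | lam' phi'. admissible d M r mu phi'}"
proof -
  interpret product_sigma_finite M by (rule M)
  define A where "A = {approx_err d M f r lam' phi' | lam' phi'. admissible d M r mu phi'}"
  define \<eta> where "\<eta> = Inf A"
  have A_ne: "A \<noteq> {}" using nonempty by (auto simp: A_def)
  have A_nonneg: "0 \<le> a" if "a \<in> A" for a using that by (auto simp: A_def approx_err_def)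
  have A_bdd: "bdd_below A" by (rule bdd_belowI) (rule A_nonneg)
  have \<eta>_le: "\<eta> \<le> approx_err d M f r lam phi" if "admissible d M r mu phi" for lam phi
    unfolding \<eta>_def using that by (intro cInf_lower A_bdd) (auto simp: A_def)
  have "0 \<le> \<eta>" unfolding \<eta>_def using A_ne A_nonneg by (intro cInf_greatest)
  have "\<exists>lam phi. admissible d M r mu phi \<and> approx_err d M f r lam phi < \<eta> + 1 / real (Suc n)" for n
  proof -
    have "\<exists>a\<in>A. a < \<eta> + 1 / real (Suc n)"
      unfolding \<eta>_def using A_ne A_bdd by (subst cInf_less_iff[symmetric]) auto
    then show ?thesis by (auto simp: A_def)
  qed
  then obtain lam phi where adm: "\<And>n. admissible d M r mu (phi n)"
    and err: "\<And>n. approx_err d M f r (lam n) (phi n) < \<eta> + 1 / real (Suc n)"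
    by metis
  have phi: "phi n k p \<in> L2 (M k)" "L2_norm (M k) (phi n k p) = 1" if "k < d" "p < r" for n k p
    using adm[of n] that by (auto simp: admissible_def)
  have err_lim: "(\<lambda>n. approx_err d M f r (lam n) (phi n)) \<longlonglongrightarrow> \<eta>"
  proof (rule tendsto_sandwich)
    show "\<forall>\<^sub>F n in sequentially. \<eta> \<le> approx_err d M f r (lam n) (phi n)"
      by (intro always_eventually allI \<eta>_le adm)
    show "\<forall>\<^sub>F n in sequentially. approx_err d M f r (lam n) (phi n) \<le> \<eta> + 1 / real (Suc n)"
      by (intro always_eventually allI less_imp_le err)
    have "(\<lambda>n. \<eta> + 1 / real (Suc n)) \<longlonglongrightarrow> \<eta> + 0"
      by (intro tendsto_intros LIMSEQ_Suc[OF lim_const_over_n])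
    then show "(\<lambda>n. \<eta> + 1 / real (Suc n)) \<longlonglongrightarrow> \<eta>" by simp
  qed simp
  define c where "c = 1 - (real r - 1) * (\<Prod>k<d. mu k)"
  \<comment> \<open>Every error of the minimising sequence is below \<open>\<eta> + 1\<close>, so
    \<open>K\<close> may be \<open>\<eta> + 1\<close> plus the norm of \<open>f\<close>.\<close>
  define B where "B = sqrt ((\<eta> + 1 + L2_norm (PiM {..<d} M) f)\<^sup>2 / c)"
  have lam_bound: "cmod (lam n p) \<le> B" if "p < r" for n p
    unfolding B_def
  proof (rule coefficients_bounded[OF M f adm mu c_def])
    show "0 < c" using coherence by (simp add: c_def)
    have "1 / real (Suc n) \<le> 1" by simp
    then show "approx_err d M f r (lam n) (phi n) + L2_norm (PiM {..<d} M) f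
        \<le> \<eta> + 1 + L2_norm (PiM {..<d} M) f"
      using err[of n] by linarith
  qed (use that in auto)
  have inner_bound: "cmod (L2_inner (M k) (phi n k p) (phi m k q)) \<le> 1" if "k < d" "p < r" "q < r" for n m k p q
    using L2_Cauchy_Schwarz[OF phi(1)[OF that(1,2)] phi(1)[OF that(1,3)]] phi(2)[OF that(1,2)]
      phi(2)[OF that(1,3)] by simp
  \<comment> \<open>The index \<open>None\<close> yields the Gram matrices, \<open>Some m\<close> the inner products with the fixed
    \<open>m\<close>-th member that weak convergence requires.\<close>
  define Q :: "nat \<Rightarrow> nat + nat \<times> nat \<times> nat \<times> nat option \<Rightarrow> complex" where
    "Q n i = (case i of Inl p \<Rightarrow> lam n p
      | Inr (k, p, q, u) \<Rightarrow> L2_inner (M k) (phi n k p)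
          (phi (case u of None \<Rightarrow> n | Some m \<Rightarrow> m) k q))" for n i
  \<comment> \<open>A single diagonal extraction serves all quantities: the index set is countable,
    \<open>B\<close> bounds the coefficients, and 1 bounds inner products of unit vectors.\<close>
  obtain s :: "nat \<Rightarrow> nat" where s: "strict_mono s"
    and Q: "\<And>i. i \<in> Inl ` {..<r} \<union> Inr ` ({..<d} \<times> {..<r} \<times> {..<r} \<times> UNIV) \<Longrightarrow> \<exists>l. (\<lambda>n. Q (s n) i) \<longlonglongrightarrow> l"
  proof (rule function_convergent_subsequence[where f = Q and M = "max B 1"
      and S = "Inl ` {..<r} \<union> Inr ` ({..<d} \<times> {..<r} \<times> {..<r} \<times> UNIV)"])
    show "countable (Inl ` {..<r} \<union> Inr ` ({..<d} \<times> {..<r} \<times> {..<r} \<times> (UNIV :: nat option set)))"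
      by (rule countableI_type)
    show "norm (Q n i) \<le> max B 1"
      if "i \<in> Inl ` {..<r} \<union> Inr ` ({..<d} \<times> {..<r} \<times> {..<r} \<times> UNIV)" for n i
      using that by (auto simp: Q_def le_max_iff_disj intro: lam_bound inner_bound split: option.split)
  qed (rule that)
  have "\<exists>l. (\<lambda>n. lam (s n) p) \<longlonglongrightarrow> l" if "p < r" for p
    using Q[of "Inl p"] that by (simp add: Q_def)
  then obtain l where l: "\<And>p. p < r \<Longrightarrow> (\<lambda>n. lam (s n) p) \<longlonglongrightarrow> l p"
    by metis
  have "\<exists>g. (\<lambda>n. L2_inner (M k) (phi (s n) k p) (phi (s n) k q)) \<longlonglongrightarrow> g"
    if "k < d" "p < r" "q < r" for k p q
    using Q[of "Inr (k, p, q, None)"] that by (simp add: Q_def image_iff)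
  then obtain G where G: "\<And>k p q. k < d \<Longrightarrow> p < r \<Longrightarrow> q < r \<Longrightarrow>
      (\<lambda>n. L2_inner (M k) (phi (s n) k p) (phi (s n) k q)) \<longlonglongrightarrow> G k p q"
    by metis
  have "\<exists>y. L2_weakly (M k) (\<lambda>n. phi (s n) k p) y" if "k < d" "p < r" for k p
  proof (rule L2_weakly_convergent)
    show "L2_norm (M k) (phi (s n) k p) \<le> 1" for n using phi(2)[OF that] by simp
    show "convergent (\<lambda>n. L2_inner (M k) (phi (s n) k p) (phi (s m) k p))" for m
      \<comment> \<open>Member \<open>m\<close> of the subsequence is member \<open>s m\<close> of
        the original sequence.\<close>
      using Q[of "Inr (k, p, p, Some (s m))"] that by (simp add: Q_def image_iff convergent_def)
  qed (rule phi(1)[OF that])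
  then obtain y where weak: "\<And>k p. k < d \<Longrightarrow> p < r \<Longrightarrow> L2_weakly (M k) (\<lambda>n. phi (s n) k p) (y k p)"
    by metis
  have y: "y k p \<in> L2 (M k)" if "k < d" "p < r" for k p
    using weak[OF that] by (simp add: L2_weakly_def)
  \<comment> \<open>The perturbation precedes the sign in the quantifiers: one \<open>e\<close> must
    serve both signs, since the sign is picked only after all modes have been treated.\<close>
  have "\<forall>k. \<exists>e. k < d \<longrightarrow> (\<forall>p<r. e p \<in> L2 (M k)) \<and> (\<forall>s\<in>{1, -1}. \<forall>p<r. \<forall>q<r.
      L2_inner (M k) (\<lambda>t. y k p t + s * e p t) (\<lambda>t. y k q t + s * e q t) = G k p q)"
  proof
    fix k
    have "\<exists>e. (\<forall>p<r. e p \<in> L2 (M k)) \<and> (\<forall>s\<in>{1, -1}. \<forall>p<r. \<forall>q<r.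
      L2_inner (M k) (\<lambda>t. y k p t + s * e p t) (\<lambda>t. y k q t + s * e q t) = G k p q)" if "k < d"
      using that by (intro L2_restore_gram[of r "\<lambda>n p. phi (s n) k p"] phi weak G)
    then show "\<exists>e. k < d \<longrightarrow> (\<forall>p<r. e p \<in> L2 (M k)) \<and> (\<forall>s\<in>{1, -1}. \<forall>p<r. \<forall>q<r.
      L2_inner (M k) (\<lambda>t. y k p t + s * e p t) (\<lambda>t. y k q t + s * e q t) = G k p q)" by blast
  qed
  from choice[OF this] obtain e where e: "\<forall>k. k < d \<longrightarrow> (\<forall>p<r. e k p \<in> L2 (M k))
      \<and> (\<forall>s\<in>{1, -1}. \<forall>p<r. \<forall>q<r.
      L2_inner (M k) (\<lambda>t. y k p t + s * e k p t) (\<lambda>t. y k q t + s * e k q t) = G k p q)"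
    by (elim exE)
  have e_L2: "e k p \<in> L2 (M k)" if "k < d" "p < r" for k p using e that by blast
  define corr where "corr a v = Re (\<Sum>p<r. cnj (a p) * L2_inner (PiM {..<d} M) f (tensor d (\<lambda>k. v k p)))"
    for a :: "nat \<Rightarrow> complex" and v :: "nat \<Rightarrow> nat \<Rightarrow> 'a \<Rightarrow> complex"
  obtain \<sigma> where \<sigma>: "\<And>k. \<sigma> k \<in> {1, -1}"
    and corr_le: "corr l y \<le> corr l (\<lambda>k p t. y k p t + \<sigma> k * e k p t)"
    using exists_signs_correlation_le[OF M f, of r y e l] y e_L2 unfolding corr_def by blast
  define psi where "psi k p = (\<lambda>t. y k p t + \<sigma> k * e k p t)" for k p
  have psi: "psi k p \<in> L2 (M k)" if "k < d" "p < r" for k p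
    unfolding psi_def using y[OF that] e_L2[OF that] by (intro L2_add L2_scale)
  have psi_gram: "L2_inner (M k) (psi k p) (psi k q) = G k p q" if "k < d" "p < r" "q < r" for k p q
    unfolding psi_def using e \<sigma>[of k] that by blast
  \<comment> \<open>Unit norm and bounded coherence are closed conditions on Gram matrices, so
    \<open>G\<close> satisfies them and \<open>psi\<close> inherits them.\<close>
  have adm_psi: "admissible d M r mu psi"
    unfolding admissible_def coherence_le_def
  proof (intro allI impI conjI)
    fix k p assume kp: "k < d" "p < r"
    show "psi k p \<in> L2 (M k)" by (rule psi[OF kp])
    have "L2_inner (M k) (phi (s n) k p) (phi (s n) k p) = 1" for n
      using phi(2)[OF kp] by (simp add: L2_inner_self)
    then have "G k p p = 1" using G[OF kp kp(2)] by (simp add: LIMSEQ_const_iff)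
    then have "complex_of_real ((L2_norm (M k) (psi k p))\<^sup>2) = 1"
      unfolding L2_inner_self[symmetric] using psi_gram[OF kp kp(2)] by simp
    then have "(L2_norm (M k) (psi k p))\<^sup>2 = 1\<^sup>2" by (simp only: of_real_eq_1_iff power_one)
    then show "L2_norm (M k) (psi k p) = 1" by (rule power2_eq_imp_eq) simp_all
  next
    fix k p q assume kpq: "k < d" "p < r" "q < r" "p \<noteq> q"
    have "cmod (G k p q) \<le> mu k"
    proof (rule LIMSEQ_le_const2[OF tendsto_norm[OF G[OF kpq(1-3)]]])
      show "\<exists>N. \<forall>n\<ge>N. norm (L2_inner (M k) (phi (s n) k p) (phi (s n) k q)) \<le> mu k"
        using adm kpq by (auto simp: admissible_def coherence_le_def)
    qed
    then show "cmod (L2_inner (M k) (psi k p) (psi k q)) \<le> mu k"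
      using psi_gram[OF kpq(1-3)] by simp
  qed
  \<comment> \<open>The correlations pass to the weak limits \<open>y\<close>, whereas the quadratic
    part tends to the form built from \<open>G\<close>, which need not be the Gram matrices of
    \<open>y\<close>. Since \<open>psi\<close> realises \<open>G\<close> and correlates with
    \<open>f\<close> at least as well as \<open>y\<close>, its squared error is at most this
    limit.\<close>
  have "(\<lambda>n. (approx_err d M f r (lam (s n)) (phi (s n)))\<^sup>2) \<longlonglongrightarrow>
      (L2_norm (PiM {..<d} M) f)\<^sup>2 - 2 * corr l y + Re (\<Sum>p<r. \<Sum>q<r. l p * cnj (l q) * (\<Prod>k<d. G k p q))"
  proof -
    have tensor_lim: "(\<lambda>n. L2_inner (PiM {..<d} M) f (tensor d (\<lambda>k. phi (s n) k p)))
        \<longlonglongrightarrow> L2_inner (PiM {..<d} M) f (tensor d (\<lambda>k. y k p))" if "p < r" for p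
      unfolding tensor_def using that phi weak
      by (intro L2_inner_prod_tendsto[where x = "\<lambda>n k. phi (s n) k p" and y = "\<lambda>k. y k p"] f) auto
    have "(\<lambda>n. (L2_norm (PiM {..<d} M) f)\<^sup>2 - 2 * corr (lam (s n)) (phi (s n))
      + Re (\<Sum>p<r. \<Sum>q<r. lam (s n) p * cnj (lam (s n) q)
          * (\<Prod>k<d. L2_inner (M k) (phi (s n) k p) (phi (s n) k q)))) \<longlonglongrightarrow>
      (L2_norm (PiM {..<d} M) f)\<^sup>2 - 2 * corr l y + Re (\<Sum>p<r. \<Sum>q<r. l p * cnj (l q) * (\<Prod>k<d. G k p q))"
      unfolding corr_def by (intro tendsto_intros tensor_lim l G) auto
    moreover have "(approx_err d M f r (lam (s n)) (phi (s n)))\<^sup>2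
      = (L2_norm (PiM {..<d} M) f)\<^sup>2 - 2 * corr (lam (s n)) (phi (s n))
      + Re (\<Sum>p<r. \<Sum>q<r. lam (s n) p * cnj (lam (s n) q)
          * (\<Prod>k<d. L2_inner (M k) (phi (s n) k p) (phi (s n) k q)))" for n
      unfolding corr_def by (rule approx_err_squared[OF M f]) (rule phi)
    ultimately show ?thesis by simp
  qed
  moreover have "(\<lambda>n. (approx_err d M f r (lam (s n)) (phi (s n)))\<^sup>2) \<longlonglongrightarrow> \<eta>\<^sup>2"
    using LIMSEQ_subseq_LIMSEQ[OF err_lim s] by (intro tendsto_power) (simp add: o_def)
  ultimately have eta_sq: "\<eta>\<^sup>2 = (L2_norm (PiM {..<d} M) f)\<^sup>2 - 2 * corr l y
      + Re (\<Sum>p<r. \<Sum>q<r. l p * cnj (l q) * (\<Prod>k<d. G k p q))"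
    by (rule LIMSEQ_unique[rotated])
  have "(approx_err d M f r l psi)\<^sup>2 = (L2_norm (PiM {..<d} M) f)\<^sup>2 - 2 * corr l psi
      + Re (\<Sum>p<r. \<Sum>q<r. l p * cnj (l q) * (\<Prod>k<d. L2_inner (M k) (psi k p) (psi k q)))"
    unfolding corr_def by (rule approx_err_squared[OF M f]) (rule psi)
  also have "(\<Sum>p<r. \<Sum>q<r. l p * cnj (l q) * (\<Prod>k<d. L2_inner (M k) (psi k p) (psi k q)))
      = (\<Sum>p<r. \<Sum>q<r. l p * cnj (l q) * (\<Prod>k<d. G k p q))"
    by (simp add: psi_gram)
  finally have "(approx_err d M f r l psi)\<^sup>2 \<le> \<eta>\<^sup>2"
    using corr_le unfolding eta_sq psi_def by simp
  then have "approx_err d M f r l psi \<le> \<eta>"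
    using \<open>0 \<le> \<eta>\<close> by (rule power2_le_imp_le)
  with \<eta>_le[OF adm_psi, of l] adm_psi show ?thesis
    unfolding \<eta>_def A_def by (intro exI[of _ l] exI[of _ psi]) auto
qed

text \<open>The constraints can be infeasible, for instance when \<open>mu k = 0\<close> and
  \<open>L2 (M k)\<close> has fewer than \<open>r\<close> orthonormal functions; the last hypothesis
  ensures that the infimum is over a nonempty set.\<close>

theorem theorem4:
  fixes d r :: nat
    and M :: "nat \<Rightarrow> 'a measure"
    and f :: "(nat \<Rightarrow> 'a) \<Rightarrow> complex"
    and mu :: "nat \<Rightarrow> real"
  assumes "d \<ge> 1" and "r \<ge> 1"
    and "\<And>k. k < d \<Longrightarrow> sigma_finite_measure (M k)"
    and "f \<in> L2 (PiM {..<d} M)"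
    and "\<And>k. k < d \<Longrightarrow> 0 \<le> mu k \<and> mu k \<le> 1"
    and "r = 1 \<or> (\<Prod>k<d. mu k) < 1 / (real r - 1)"
    and "\<exists>phi. admissible d M r mu phi"
  shows "\<exists>lam phi. admissible d M r mu phi \<and>
           approx_err d M f r lam phi
             = Inf {approx_err d M f r lam' phi' | lam' phi'. admissible d M r mu phi'}"
proof -
  \<comment> \<open>\<open>product_sigma_finite\<close> asks for sigma-finiteness at every natural
    number, so the indices from \<open>d\<close> on receive a trivial measure; products over
    \<open>{..<d}\<close> are unaffected.\<close>
  define M' where "M' k = (if k < d then M k else count_space {})" for k
  have M': "product_sigma_finite M'"
    unfolding M'_def using assms(3)
    by (intro product_sigma_finite.intro) (auto intro: sigma_finite_measure_count_space_finite)
  have PiM: "PiM {..<d} M' = PiM {..<d} M"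
    by (rule PiM_cong) (auto simp: M'_def)
  have adm: "admissible d M' r mu phi \<longleftrightarrow> admissible d M r mu phi" for phi
    by (simp add: admissible_def M'_def)
  have err: "approx_err d M' f r lam phi = approx_err d M f r lam phi" for lam phi
    by (simp add: approx_err_def PiM)
  \<comment> \<open>The multiplied form also covers \<open>r = 1\<close>, where the quotient
    \<open>1 / (real r - 1)\<close> would be 0 by the convention for division.\<close>
  have "(real r - 1) * (\<Prod>k<d. mu k) < 1"
  proof (cases "r = 1")
    case False
    then have "0 < real r - 1" using assms(2) by simp
    then show ?thesis using assms(6) False by (simp add: field_simps)
  qed simp
  then show ?thesis
    using infimum_attained[OF M', of f d mu r] assms(4,5,7) unfolding PiM adm err by blast
qed

end
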